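(* Let $p\in[0,1]$ and let $1\le k\le n$ be integers. Let $T(n,p)$ be the random threshold graph with parameters $n$ and $p$, and let $\lambda(T(n,p))$ be its associated anti-lecture hall composition. Put $m=n-k+1$. Then $$\mathbb{E}\big(\lambda_k(T(n,p))\big)=\sum_{1\le i\le m\le j\le n}\binom{j-i}{m-i}\,p^{\,j-m+1}(1-p)^{m-i},$$ where the sum is over all integers $i,j$ with $1\le i\le m\le j\le n$ (and $0^0=1$).
   Context: For $n\ge 1$ and $\sigma\subseteq\{1,\dots,n\}$, $T(n,\sigma)$ is the (threshold) graph with vertex set $\{0,1,\dots,n\}$ in which, for $0\le u<v\le n$, the pair $uv$ is an edge if and only if $v\notin\sigma$. The random threshold graph $T(n,p)$, for $p\in[0,1]$, is $T(n,\sigma)$ where $\sigma$ is the random subset of $\{1,\dots,n\}$ containing each $i$ independently with probability $p$. Let $\Bbbk$ be a field and $R=\Bbbk[x_0,\dots,x_n]$. For a threshold graph $T=T(n,\sigma)$, let $I_c(T)=\langle x_ux_v\mid u\neq v,\ uv\notin E(T)\rangle$ and $\Bbbk[T]=R/I_c(T)$. The graded Betti numbers $\beta_{i,j}(\Bbbk[T])$ vanish unless $j=i+1$ or $(i,j)=(0,0)$; set $\beta_k(T)=\beta_{k,k+1}(\Bbbk[T])$ for $1\le k\le n$. The anti-lecture hall composition associated to $T$ is $\lambda(T)=(\lambda_1(T),\dots,\lambda_n(T))$ with $$\lambda_i(T)=\sum_{k=i}^n(-1)^{i+k}\binom{k-1}{i-1}\beta_k(T).$$ It is an integer sequence satisfying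 $1\ge\lambda_1/1\ge\lambda_2/2\ge\cdots\ge\lambda_n/n\ge0$. *)

theory Defs
  imports
    "HOL-Probability.Probability"
    "HOL-Algebra.QuotRing"
    "HOL-Library.Poly_Mapping"
begin

section \<open>Polynomial rings\<close>

type_synonym 'a mpoly = "(nat \<Rightarrow>\<^sub>0 nat) \<Rightarrow>\<^sub>0 'a"

definition var :: "nat \<Rightarrow> 'a::field mpoly" where
  "var v = Poly_Mapping.single (Poly_Mapping.single v 1) 1"

text \<open>The polynomial ring over the field \<open>'a\<close> in the variables \<open>x\<^sub>v\<close>, \<open>v \<in> V\<close>, as a
  subring of the polynomials in all variables \<open>x\<^sub>0, x\<^sub>1, \<dots>\<close>.\<close>

definition poly_ring :: "nat set \<Rightarrow> 'a::field mpoly ring" where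
  "poly_ring V = \<lparr>carrier = {f. \<forall>m\<in>Poly_Mapping.keys f. Poly_Mapping.keys m \<subseteq> V},
     monoid.mult = (*), one = 1, zero = 0, add = (+)\<rparr>"

definition mon_degree :: "(nat \<Rightarrow>\<^sub>0 nat) \<Rightarrow> nat" where
  "mon_degree m = (\<Sum>v\<in>Poly_Mapping.keys m. Poly_Mapping.lookup m v)"

definition irrelevant_ideal :: "nat set \<Rightarrow> 'a::field mpoly set" where
  "irrelevant_ideal V = Idl\<^bsub>poly_ring V\<^esub> (var ` V)"


section \<open>Graded Betti numbers\<close>

text \<open>The free module of rank \<open>r\<close>; coordinate vectors are continued by zero beyond \<open>r\<close>.\<close>

definition free_module :: "nat set \<Rightarrow> nat \<Rightarrow> (nat \<Rightarrow> 'a::field mpoly) set" where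
  "free_module V r = {v. (\<forall>a<r. v a \<in> carrier (poly_ring V)) \<and> (\<forall>a\<ge>r. v a = 0)}"

definition mat_apply ::
  "nat \<Rightarrow> nat \<Rightarrow> (nat \<Rightarrow> nat \<Rightarrow> 'a::field mpoly) \<Rightarrow> (nat \<Rightarrow> 'a mpoly) \<Rightarrow> nat \<Rightarrow> 'a mpoly" where
  "mat_apply r s A v = (\<lambda>a. if a < r then \<Sum>b<s. A a b * v b else 0)"

text \<open>
  A graded complex \<open>\<dots> \<rightarrow> F\<^sub>2 \<rightarrow> F\<^sub>1 \<rightarrow> F\<^sub>0 \<rightarrow> R/I\<close> of finitely generated graded free modules:
  \<^item> \<open>F\<^sub>i\<close> is the direct sum of the \<open>R(-d)\<close>, where \<open>d\<close> runs through the list \<open>shifts F i\<close>, so that its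
    \<open>a\<close>-th basis vector has degree \<open>shifts F i ! a\<close>;
  \<^item> \<open>diff F (Suc i)\<close> is the matrix of the differential from \<open>F\<^sub>i\<^sub>+\<^sub>1\<close> to \<open>F\<^sub>i\<close>
    (\<open>diff F 0\<close> is not used);
  \<^item> \<open>aug F a\<close> is a representative of the image in \<open>R/I\<close> of the \<open>a\<close>-th basis vector of \<open>F\<^sub>0\<close>.
\<close>

record (overloaded) 'a graded_complex =
  shifts :: "nat \<Rightarrow> nat list"
  diff :: "nat \<Rightarrow> nat \<Rightarrow> nat \<Rightarrow> 'a mpoly"
  aug :: "nat \<Rightarrow> 'a mpoly"

definition frank :: "'a::field graded_complex \<Rightarrow> nat \<Rightarrow> nat" where
  "frank F i = length (shifts F i)"

definition differential ::
  "'a::field graded_complex \<Rightarrow> nat \<Rightarrow> (nat \<Rightarrow> 'a mpoly) \<Rightarrow> nat \<Rightarrow> 'a mpoly" where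
  "differential F i = mat_apply (frank F (i - 1)) (frank F i) (diff F i)"

definition augmentation ::
  "nat set \<Rightarrow> 'a::field mpoly set \<Rightarrow> 'a graded_complex \<Rightarrow> (nat \<Rightarrow> 'a mpoly) \<Rightarrow> 'a mpoly set" where
  "augmentation V I F v = I +>\<^bsub>poly_ring V\<^esub> (\<Sum>a<frank F 0. v a * aug F a)"

text \<open>The maps preserve degrees: a nonzero matrix entry taking the basis vector \<open>b\<close> of \<open>F\<^sub>i\<^sub>+\<^sub>1\<close> to
  the basis vector \<open>a\<close> of \<open>F\<^sub>i\<close> is homogeneous of degree
  \<open>shifts F (i + 1) ! b - shifts F i ! a\<close>.\<close>

definition is_graded :: "nat set \<Rightarrow> 'a::field graded_complex \<Rightarrow> bool" where
  "is_graded V F \<longleftrightarrow>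
     (\<forall>a<frank F 0. aug F a \<in> carrier (poly_ring V) \<and>
        (\<forall>m\<in>Poly_Mapping.keys (aug F a). mon_degree m = shifts F 0 ! a)) \<and>
     (\<forall>i. \<forall>a<frank F i. \<forall>b<frank F (Suc i).
        diff F (Suc i) a b \<in> carrier (poly_ring V) \<and>
        (\<forall>m\<in>Poly_Mapping.keys (diff F (Suc i) a b).
           mon_degree m + shifts F i ! a = shifts F (Suc i) ! b))"

definition is_resolution ::
  "nat set \<Rightarrow> 'a::field mpoly set \<Rightarrow> 'a graded_complex \<Rightarrow> bool" where
  "is_resolution V I F \<longleftrightarrow>
     augmentation V I F ` free_module V (frank F 0) = carrier (poly_ring V Quot I) \<and>
     {v \<in> free_module V (frank F 0). augmentation V I F v = \<zero>\<^bsub>poly_ring V Quot I\<^esub>}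
       = differential F 1 ` free_module V (frank F 1) \<and>
     (\<forall>i\<ge>1. {v \<in> free_module V (frank F i). differential F i v = (\<lambda>_. 0)}
       = differential F (Suc i) ` free_module V (frank F (Suc i)))"

definition is_minimal :: "nat set \<Rightarrow> 'a::field graded_complex \<Rightarrow> bool" where
  "is_minimal V F \<longleftrightarrow>
     (\<forall>i. \<forall>a<frank F i. \<forall>b<frank F (Suc i). diff F (Suc i) a b \<in> irrelevant_ideal V)"

definition minimal_graded_free_resolution ::
  "nat set \<Rightarrow> 'a::field mpoly set \<Rightarrow> 'a graded_complex \<Rightarrow> bool" where
  "minimal_graded_free_resolution V I F \<longleftrightarrow>
     is_graded V F \<and> is_resolution V I F \<and> is_minimal V F"

text \<open>\<open>graded_betti V I i j\<close> is the graded Betti number \<open>\<beta>\<^sub>i\<^sub>,\<^sub>j(R/I)\<close> for a homogeneous ideal \<open>I\<close> of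
  \<open>R = poly_ring V\<close>, \<open>V\<close> finite: the number of summands \<open>R(-j)\<close> in step \<open>i\<close> of the minimal graded
  free resolution of \<open>R/I\<close>, which is unique up to isomorphism.\<close>

definition graded_betti :: "nat set \<Rightarrow> 'a::field mpoly set \<Rightarrow> nat \<Rightarrow> nat \<Rightarrow> nat" where
  "graded_betti V I i j =
     (THE b. \<exists>F. minimal_graded_free_resolution V I F \<and> b = count_list (shifts F i) j)"


section \<open>Threshold graphs\<close>

text \<open>Graphs are pairs of a vertex set and a set of two-element sets of vertices.\<close>

type_synonym graph = "nat set \<times> nat set set"

definition threshold_graph :: "nat \<Rightarrow> nat set \<Rightarrow> graph" where
  "threshold_graph n \<sigma> = ({0..n}, {{u, v} | u v. u < v \<and> v \<le> n \<and> v \<notin> \<sigma>})"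

definition random_threshold_graph :: "nat \<Rightarrow> real \<Rightarrow> graph pmf" where
  "random_threshold_graph n p =
     map_pmf (\<lambda>f. threshold_graph n {i \<in> {1..n}. f i})
       (Pi_pmf {1..n} False (\<lambda>_. bernoulli_pmf p))"

definition nonedge_ideal :: "graph \<Rightarrow> 'a::field mpoly set" where
  "nonedge_ideal T = Idl\<^bsub>poly_ring (fst T)\<^esub>
     {var u * var v | u v. u \<in> fst T \<and> v \<in> fst T \<and> u \<noteq> v \<and> {u, v} \<notin> snd T}"

text \<open>The argument of type \<open>'a itself\<close> in the following definitions is the coefficient field.\<close>

definition betti :: "'a::field itself \<Rightarrow> graph \<Rightarrow> nat \<Rightarrow> nat" where
  "betti _ T k = graded_betti (fst T) (nonedge_ideal T :: 'a mpoly set) k (k + 1)"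

text \<open>The parts \<open>\<lambda>\<^sub>i(T)\<close>, \<open>1 \<le> i \<le> n\<close>, of the anti-lecture hall composition of a threshold graph
  \<open>T\<close> with vertex set \<open>{0..n}\<close>.\<close>

definition alh_composition :: "'a::field itself \<Rightarrow> nat \<Rightarrow> graph \<Rightarrow> nat \<Rightarrow> int" where
  "alh_composition K n T i =
     (\<Sum>k=i..n. (-1) ^ (i + k) * int ((k - 1) choose (i - 1)) * int (betti K T k))"

end

theory Submission
  imports Defs
begin

text \<open>
  Let \<open>R = k[x\<^sub>0, \<dots>, x\<^sub>n]\<close>. Order the generators \<open>x\<^sub>u x\<^sub>v\<close> (\<open>u < v\<close>, \<open>v \<in> \<sigma>\<close>) of the ideal \<open>I\<^sub>c(T(n, \<sigma>))\<close> by \<open>v\<close>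
  and then by \<open>u\<close>. The colon ideal of the earlier generators by \<open>x\<^sub>u x\<^sub>v\<close> is generated by the variables
  \<open>x\<^sub>a\<close> with \<open>a < u\<close>, or with \<open>u < a < v\<close> and \<open>a \<in> \<sigma>\<close>. Hence an iterated mapping cone of Koszul
  complexes, themselves iterated mapping cones, resolves \<open>R/I\<^sub>c(T)\<close>; it is minimal for degree
  reasons, and it contributes \<open>c(u, v) choose (k - 1)\<close> to \<open>\<beta>\<^sub>k\<close> for each generator, where
  \<open>c(u, v) = u + |\<sigma> \<inter> {u+1, \<dots>, v-1}|\<close>. The shifts of any two minimal graded resolutions agree,
  because chain maps lifting the identity in both directions compose to maps homotopic to the
  identity and are therefore inverse to each other modulo the irrelevant ideal.

  Binomial inversion turns the formula for the \<open>\<beta>\<^sub>k\<close> into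
  \<open>\<lambda>\<^sub>k(T) = |{(u, v). u < v, v \<in> \<sigma>, c(u, v) = k - 1}|\<close>. For a random \<open>\<sigma>\<close> the event \<open>v \<in> \<sigma>\<close> is
  independent of the binomial variable \<open>c(u, v) - u\<close>, and the substitution \<open>i = n + 1 - v\<close>,
  \<open>j = n - u\<close> gives the stated sum.
\<close>

section \<open>Polynomials and monomial ideals\<close>

text \<open>\<open>graded_betti\<close> is a definite description, so an explicit minimal resolution
  yields Betti numbers only together with uniqueness of the shifts. Both rest on one lifting result,
  \<open>chain_map_exists\<close>: with \<open>f = 1\<close> it compares two resolutions, and with
  \<open>f\<close> a generator it connects the two complexes of a mapping cone. For this the ring
  itself is kept as position 0 of every complex, where a chain map is multiplication by
  \<open>f\<close>; the price is that equations there hold only modulo an ideal. The degree argument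
  for minimality is this. Generators have degree 2. In position \<open>i + 1\<close> the Koszul
  complex, shifted by 2, lives in degree \<open>i + 2\<close>, whereas the complex built so far
  lives in degree \<open>i + 1\<close>, or 0 if \<open>i = 0\<close>. So no entry of the comparison
  map can be a nonzero constant. Monomial ideals are represented by sets of exponent vectors. Adding
  a generator and forming a colon ideal thereby become operations on sets.\<close>

lemma mon_degree_superset:
  assumes "finite A" "Poly_Mapping.keys m \<subseteq> A"
  shows "mon_degree m = (\<Sum>v\<in>A. Poly_Mapping.lookup m v)"
  unfolding mon_degree_def by (rule sum.mono_neutral_left) (use assms in \<open>auto simp: in_keys_iff\<close>)

lemma mon_degree_add: "mon_degree (m + m') = mon_degree m + mon_degree m'"
proof -
  let ?A = "Poly_Mapping.keys m \<union> Poly_Mapping.keys m'"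
  have "mon_degree (m + m') = (\<Sum>v\<in>?A. Poly_Mapping.lookup (m + m') v)"
    by (rule mon_degree_superset) (auto simp: keys_add)
  moreover have "mon_degree m = (\<Sum>v\<in>?A. Poly_Mapping.lookup m v)"
    by (rule mon_degree_superset) auto
  moreover have "mon_degree m' = (\<Sum>v\<in>?A. Poly_Mapping.lookup m' v)"
    by (rule mon_degree_superset) auto
  ultimately show ?thesis by (simp add: lookup_add sum.distrib)
qed

lemma mon_degree_zero [simp]: "mon_degree 0 = 0"
  by (simp add: mon_degree_def)

lemma mon_degree_single [simp]: "mon_degree (Poly_Mapping.single v c) = c"
  by (simp add: mon_degree_def)

lemma keys_add_nat:
  "Poly_Mapping.keys (m + m' :: nat \<Rightarrow>\<^sub>0 nat) = Poly_Mapping.keys m \<union> Poly_Mapping.keys m'"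
  by (auto simp: in_keys_iff lookup_add)

lemma keys_mult_subset:
  assumes "m \<in> Poly_Mapping.keys (f * g)"
  obtains a b where "a \<in> Poly_Mapping.keys f" "b \<in> Poly_Mapping.keys g" "m = a + b"
  using assms keys_mult[of f g] by blast

section \<open>Polynomials in a given set of variables, and restriction to a set of
  monomials\<close>

definition polys :: "nat set \<Rightarrow> 'a::field mpoly set" where
  "polys V = {f. \<forall>m\<in>Poly_Mapping.keys f. Poly_Mapping.keys m \<subseteq> V}"

lemma carrier_poly_ring [simp]: "carrier (poly_ring V) = polys V"
  by (simp add: poly_ring_def polys_def)

lemma polys_zero [simp]: "0 \<in> polys V" by (simp add: polys_def)
lemma polys_one [simp]: "1 \<in> polys V" by (simp add: polys_def)
lemma polys_add [intro]: "f \<in> polys V \<Longrightarrow> g \<in> polys V \<Longrightarrow> f + g \<in> polys V"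
  using keys_add[of f g] by (fastforce simp: polys_def)
lemma polys_uminus [intro]: "f \<in> polys V \<Longrightarrow> - f \<in> polys V"
  by (simp add: polys_def in_keys_iff)
lemma polys_diff [intro]: "f \<in> polys V \<Longrightarrow> g \<in> polys V \<Longrightarrow> f - g \<in> polys V"
  using polys_add[of f V "- g"] by auto
lemma polys_mult [intro]: "f \<in> polys V \<Longrightarrow> g \<in> polys V \<Longrightarrow> f * g \<in> polys V"
  unfolding polys_def by (fastforce elim!: keys_mult_subset simp: keys_add_nat)
lemma polys_sum [intro]: "(\<And>a. a \<in> A \<Longrightarrow> f a \<in> polys V) \<Longrightarrow> (\<Sum>a\<in>A. f a) \<in> polys V"
  by (induction A rule: infinite_finite_induct) auto

text \<open>With a condition on degrees this is a homogeneous component; with membership in a set of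
  exponents it splits off the part lying in a monomial ideal.\<close>

definition restr :: "('b \<Rightarrow> bool) \<Rightarrow> ('b \<Rightarrow>\<^sub>0 'c::zero) \<Rightarrow> ('b \<Rightarrow>\<^sub>0 'c)" where
  "restr P = Poly_Mapping.mapp (\<lambda>m c. if P m then c else 0)"

lemma lookup_restr: "Poly_Mapping.lookup (restr P f) m = (if P m then Poly_Mapping.lookup f m else 0)"
  by (simp add: restr_def lookup_mapp in_keys_iff when_def)

lemma keys_restr: "Poly_Mapping.keys (restr P f) = {m \<in> Poly_Mapping.keys f. P m}"
  by (auto simp: in_keys_iff lookup_restr split: if_splits)

lemma restr_zero [simp]: "restr P 0 = 0"
  by (rule poly_mapping_eqI) (simp add: lookup_restr)

lemma restr_add: "restr P (f + g :: 'b \<Rightarrow>\<^sub>0 'c::monoid_add) = restr P f + restr P g"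
  by (rule poly_mapping_eqI) (simp add: lookup_restr lookup_add)

lemma restr_diff: "restr P (f - g :: 'b \<Rightarrow>\<^sub>0 'c::ab_group_add) = restr P f - restr P g"
  by (rule poly_mapping_eqI) (simp add: lookup_restr lookup_minus)

lemma restr_sum: "restr P (\<Sum>a\<in>A. f a :: 'b \<Rightarrow>\<^sub>0 'c::comm_monoid_add) = (\<Sum>a\<in>A. restr P (f a))"
  by (induction A rule: infinite_finite_induct) (auto simp: restr_add)

lemma restr_id: "(\<And>m. m \<in> Poly_Mapping.keys f \<Longrightarrow> P m) \<Longrightarrow> restr P f = f"
  by (rule poly_mapping_eqI) (auto simp: lookup_restr in_keys_iff)

lemma restr_none: "(\<And>m. m \<in> Poly_Mapping.keys f \<Longrightarrow> \<not> P m) \<Longrightarrow> restr P f = 0"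
  by (rule poly_mapping_eqI) (auto simp: lookup_restr in_keys_iff)

lemma restr_split: "f = restr P f + restr (\<lambda>m. \<not> P m) (f :: 'b \<Rightarrow>\<^sub>0 'c::monoid_add)"
  by (rule poly_mapping_eqI) (auto simp: lookup_restr lookup_add)

text \<open>Terms of \<open>g\<close> outside \<open>Q\<close> only produce monomials outside
  \<open>P\<close>, and terms inside \<open>Q\<close> only monomials inside \<open>P\<close>. For
  homogeneous \<open>f\<close> this makes multiplication by \<open>f\<close> compatible with
  homogeneous components.\<close>

lemma restr_mult:
  fixes f g :: "'a::field mpoly"
  assumes "\<And>m m'. m \<in> Poly_Mapping.keys f \<Longrightarrow> P (m + m') \<longleftrightarrow> Q m'"
  shows "restr P (f * g) = f * restr Q g"
proof -
  have "restr P (f * g) = restr P (f * restr Q g + f * restr (\<lambda>m. \<not> Q m) g)"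
    by (subst (1) restr_split[of g Q]) (simp add: distrib_left)
  also have "\<dots> = restr P (f * restr Q g) + restr P (f * restr (\<lambda>m. \<not> Q m) g)"
    by (rule restr_add)
  also have "restr P (f * restr Q g) = f * restr Q g"
    by (rule restr_id) (auto elim!: keys_mult_subset simp: keys_restr assms)
  also have "restr P (f * restr (\<lambda>m. \<not> Q m) g) = 0"
    by (rule restr_none) (auto elim!: keys_mult_subset simp: keys_restr assms)
  finally show ?thesis by simp
qed

lemma polys_restr [intro]: "f \<in> polys V \<Longrightarrow> restr P f \<in> polys V"
  by (auto simp: polys_def keys_restr)

section \<open>Constant coefficients\<close>

lemma add_eq_zero_mon: "(a :: nat \<Rightarrow>\<^sub>0 nat) + b = 0 \<longleftrightarrow> a = 0 \<and> b = 0"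
  by (auto simp: poly_mapping_eq_iff fun_eq_iff lookup_add)

lemma const_coeff_mult_eq_0:
  fixes f g :: "'a::field mpoly"
  assumes "Poly_Mapping.lookup f 0 = 0"
  shows "Poly_Mapping.lookup (f * g) 0 = 0"
proof (rule ccontr)
  assume "Poly_Mapping.lookup (f * g) 0 \<noteq> 0"
  hence "0 \<in> Poly_Mapping.keys (f * g)" by (simp add: in_keys_iff)
  then obtain a b where "a \<in> Poly_Mapping.keys f" "0 = a + b" by (rule keys_mult_subset)
  thus False using assms by (metis add_eq_zero_mon in_keys_iff)
qed

text \<open>The constant coefficient is reduction modulo the irrelevant ideal; multiplicativity
  allows matrices of polynomials to be reduced to matrices over the field.\<close>

lemma const_coeff_mult:
  fixes f g :: "'a::field mpoly"
  shows "Poly_Mapping.lookup (f * g) 0 = Poly_Mapping.lookup f 0 * Poly_Mapping.lookup g 0"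
proof -
  let ?c = "\<lambda>f :: 'a mpoly. Poly_Mapping.lookup f 0"
  let ?C = "\<lambda>f :: 'a mpoly. Poly_Mapping.single (0 :: nat \<Rightarrow>\<^sub>0 nat) (?c f)"
  have 1: "?c (f - ?C f) = 0" "?c (g - ?C g) = 0" by (simp_all add: lookup_minus)
  have "f * g = (f - ?C f) * g + ((g - ?C g) * ?C f + ?C f * ?C g)"
    by (simp add: algebra_simps)
  hence "?c (f * g) = ?c (?C f * ?C g)"
    by (simp add: lookup_add const_coeff_mult_eq_0[OF 1(1)] const_coeff_mult_eq_0[OF 1(2)])
  thus ?thesis by (simp add: mult_single)
qed

text \<open>Given by exponents instead of generators: membership is decided monomial by monomial,
  and the colon by a monomial \<open>g\<close> is the preimage of \<open>U\<close> under adding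
  \<open>g\<close>.\<close>

definition monomial_ideal :: "nat set \<Rightarrow> (nat \<Rightarrow>\<^sub>0 nat) set \<Rightarrow> 'a::field mpoly set" where
  "monomial_ideal V U = {f \<in> polys V. Poly_Mapping.keys f \<subseteq> U}"

definition up_closed :: "(nat \<Rightarrow>\<^sub>0 nat) set \<Rightarrow> bool" where
  "up_closed U \<longleftrightarrow> (\<forall>m\<in>U. \<forall>m'. m + m' \<in> U)"

text \<open>The last conjunct, closure under homogeneous components, is what permits lifts to be
  chosen homogeneous. The zero ideal is included, so that exact equations and equations modulo
  \<open>I\<close> can be handled together.\<close>

definition homogeneous_ideal :: "nat set \<Rightarrow> 'a::field mpoly set \<Rightarrow> bool" where
  "homogeneous_ideal V I \<longleftrightarrow> I \<subseteq> polys V \<and> 0 \<in> I \<and> (\<forall>f\<in>I. \<forall>g\<in>I. f + g \<in> I) \<and>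
     (\<forall>f\<in>I. \<forall>r\<in>polys V. r * f \<in> I) \<and> (\<forall>f\<in>I. \<forall>d. restr (\<lambda>m. mon_degree m = d) f \<in> I)"

lemma homogeneous_ideal_monomial:
  assumes "up_closed U"
  shows "homogeneous_ideal V (monomial_ideal V U :: 'a::field mpoly set)"
  unfolding homogeneous_ideal_def
proof (intro conjI ballI allI)
  fix f g :: "'a mpoly"
  assume "f \<in> monomial_ideal V U" "g \<in> monomial_ideal V U"
  thus "f + g \<in> monomial_ideal V U" using keys_add[of f g] by (auto simp: monomial_ideal_def)
next
  fix f g :: "'a mpoly"
  assume "f \<in> monomial_ideal V U" "g \<in> polys V"
  thus "g * f \<in> monomial_ideal V U" using assms
    by (auto simp: monomial_ideal_def up_closed_def elim!: keys_mult_subset)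
       (metis add.commute subsetD)
qed (auto simp: monomial_ideal_def keys_restr)

lemma homogeneous_ideal_zero: "homogeneous_ideal V {0}"
  by (auto simp: homogeneous_ideal_def)

context
  fixes V and I :: "'a::field mpoly set"
  assumes I: "homogeneous_ideal V I"
begin

lemma hideal_zero: "0 \<in> I" using I by (simp add: homogeneous_ideal_def)
lemma hideal_add: "f \<in> I \<Longrightarrow> g \<in> I \<Longrightarrow> f + g \<in> I" using I by (simp add: homogeneous_ideal_def)
lemma hideal_mult: "f \<in> I \<Longrightarrow> r \<in> polys V \<Longrightarrow> r * f \<in> I" using I by (simp add: homogeneous_ideal_def)
lemma hideal_polys: "f \<in> I \<Longrightarrow> f \<in> polys V" using I by (auto simp: homogeneous_ideal_def)
lemma hideal_uminus: "f \<in> I \<Longrightarrow> - f \<in> I" using hideal_mult[of f "-1"] polys_uminus[OF polys_one] by auto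
lemma hideal_diff: "f \<in> I \<Longrightarrow> g \<in> I \<Longrightarrow> f - g \<in> I" using hideal_add[of f "-g"] hideal_uminus by auto
lemma hideal_sum: "(\<And>a. a \<in> A \<Longrightarrow> f a \<in> I) \<Longrightarrow> (\<Sum>a\<in>A. f a) \<in> I"
  by (induction A rule: infinite_finite_induct) (auto simp: hideal_zero hideal_add)
text \<open>The form with \<open>c\<close> fits a summand generated in degree \<open>c\<close>.
  Degrees are natural numbers, so for \<open>d < c\<close> the component is 0.\<close>

lemma hideal_restr: "f \<in> I \<Longrightarrow> restr (\<lambda>m. mon_degree m + c = d) f \<in> I"
proof -
  assume f: "f \<in> I"
  have "restr (\<lambda>m. mon_degree m + c = d) f = (if c \<le> d then restr (\<lambda>m. mon_degree m = d - c) f else 0)"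
    by (rule poly_mapping_eqI) (auto simp: lookup_restr)
  thus ?thesis using f I by (auto simp: homogeneous_ideal_def)
qed
lemma hideal_cong: "f - g \<in> I \<Longrightarrow> f \<in> I \<longleftrightarrow> g \<in> I"
  using hideal_add[of "f - g" g] hideal_diff[of f "f - g"] by auto

end

section \<open>Augmented graded resolutions and lifting of chain maps\<close>

definition linear_map :: "((nat \<Rightarrow> 'a::field mpoly) \<Rightarrow> nat \<Rightarrow> 'a mpoly) \<Rightarrow> bool" where
  "linear_map f \<longleftrightarrow> (\<forall>c v w. f (\<lambda>a. c * v a + w a) = (\<lambda>a. c * f v a + f w a))"

definition basis :: "nat \<Rightarrow> nat \<Rightarrow> 'a::field mpoly" where
  "basis b = (\<lambda>a. if a = b then 1 else 0)"

lemma linear_mapD: "linear_map f \<Longrightarrow> f (\<lambda>a. c * v a + w a) = (\<lambda>a. c * f v a + f w a)"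
  by (simp add: linear_map_def)

lemma linear_zero: assumes "linear_map f" shows "f (\<lambda>_. 0) = (\<lambda>_. 0)"
  \<comment> \<open>The choice \<open>c = -1\<close> with both vectors zero gives
    \<open>f 0 = - f 0 + f 0\<close>.\<close>
  using linear_mapD[OF assms, of "-1" "\<lambda>_. 0" "\<lambda>_. 0"] by (auto simp: fun_eq_iff)

lemma linear_add: "linear_map f \<Longrightarrow> f (\<lambda>a. v a + w a) = (\<lambda>a. f v a + f w a)"
  using linear_mapD[of f 1 v w] by simp

lemma linear_scale: "linear_map f \<Longrightarrow> f (\<lambda>a. c * v a) = (\<lambda>a. c * f v a)"
  using linear_mapD[of f c v "\<lambda>_. 0"] by (simp add: linear_zero)

lemma linear_uminus: "linear_map f \<Longrightarrow> f (\<lambda>a. - v a) = (\<lambda>a. - f v a)"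
  using linear_scale[of f "-1" v] by simp

lemma linear_sub: "linear_map f \<Longrightarrow> f (\<lambda>a. v a - w a) = (\<lambda>a. f v a - f w a)"
  using linear_mapD[of f "-1" w v] by simp

lemma linear_compose: "linear_map f \<Longrightarrow> linear_map g \<Longrightarrow> linear_map (\<lambda>v. f (g v))"
  by (simp add: linear_map_def)

lemma linear_diff: "linear_map f \<Longrightarrow> linear_map g \<Longrightarrow> linear_map (\<lambda>v a. f v a - g v a)"
  by (simp add: linear_map_def algebra_simps)

lemma linear_id: "linear_map (\<lambda>v. v)"
  by (simp add: linear_map_def)

lemma linear_mat_apply: "linear_map (mat_apply r s A)"
  by (auto simp: linear_map_def mat_apply_def fun_eq_iff sum.distrib sum_distrib_left algebra_simps)

lemma linear_expand:
  assumes f: "linear_map f" and v: "\<And>a. a \<ge> r \<Longrightarrow> v a = 0"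
  shows "f v a = (\<Sum>b<r. v b * f (basis b) a)"
  using v
proof (induction r arbitrary: v)
  case 0
  hence "v = (\<lambda>_. 0)" by auto
  thus ?case by (simp add: linear_zero[OF f])
next
  case (Suc r)
  have "v = (\<lambda>a. v r * basis r a + (v(r := 0)) a)"
    by (auto simp: basis_def)
  hence "f v a = v r * f (basis r) a + f (v(r := 0)) a"
    using linear_mapD[OF f, of "v r" "basis r" "v(r := 0)"] by simp
  also have "f (v(r := 0)) a = (\<Sum>b<r. (v(r := 0)) b * f (basis b) a)"
    by (rule Suc.IH) (use Suc.prems in auto)
  finally show ?case by simp
qed

lemma free_moduleD:
  "v \<in> free_module V r \<Longrightarrow> v a \<in> polys V"
  "v \<in> free_module V r \<Longrightarrow> a \<ge> r \<Longrightarrow> v a = 0"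
  by (cases "a < r"; auto simp: free_module_def)+

lemma basis_in_free [intro]: "b < r \<Longrightarrow> basis b \<in> free_module V r"
  by (auto simp: free_module_def basis_def)

lemma free_module_diff: "v \<in> free_module V r \<Longrightarrow> w \<in> free_module V r \<Longrightarrow> (\<lambda>a. v a - w a) \<in> free_module V r"
  by (auto simp: free_module_def)

lemma free_module_add: "v \<in> free_module V r \<Longrightarrow> w \<in> free_module V r \<Longrightarrow> (\<lambda>a. v a + w a) \<in> free_module V r"
  by (auto simp: free_module_def)

lemma free_module_uminus: "v \<in> free_module V r \<Longrightarrow> (\<lambda>a. - v a) \<in> free_module V r"
  by (auto simp: free_module_def)

text \<open>Reduces identities between linear maps modulo \<open>J\<close> to basis vectors;
  \<open>J = {0}\<close> gives exact identities.\<close>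

lemma linear_in_ideal:
  assumes "homogeneous_ideal V J" "linear_map f" "v \<in> free_module V r"
    and "\<And>b. b < r \<Longrightarrow> f (basis b) a \<in> J"
  shows "f v a \<in> J"
proof -
  have "f v a = (\<Sum>b<r. v b * f (basis b) a)"
    by (rule linear_expand) (use assms free_moduleD in auto)
  also have "\<dots> \<in> J"
    using assms(4) free_moduleD(1)[OF assms(3)]
    by (intro hideal_sum[OF assms(1)] hideal_mult[OF assms(1)]) auto
  finally show ?thesis .
qed

lemma mat_apply_free:
  assumes "\<And>a b. a < r \<Longrightarrow> b < q \<Longrightarrow> A a b \<in> polys V" "v \<in> free_module V q"
  shows "mat_apply r q A v \<in> free_module V r"
  using assms by (auto simp: free_module_def mat_apply_def intro!: polys_sum polys_mult)

lemma mat_apply_basis: "b < q \<Longrightarrow> mat_apply r q A (basis b) = (\<lambda>a. if a < r then A a b else 0)"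
proof
  fix a assume b: "b < q"
  have "(\<Sum>c<q. A a c * basis b c) = (\<Sum>c<q. if b = c then A a c else 0)"
    by (rule sum.cong) (auto simp: basis_def)
  thus "mat_apply r q A (basis b) a = (if a < r then A a b else 0)"
    using b by (simp add: mat_apply_def)
qed

section \<open>Homogeneous components of vectors, and homogeneous matrices\<close>

definition vec_comp :: "nat list \<Rightarrow> nat \<Rightarrow> (nat \<Rightarrow> 'a::field mpoly) \<Rightarrow> nat \<Rightarrow> 'a mpoly" where
  "vec_comp t k v = (\<lambda>a. restr (\<lambda>m. mon_degree m + t ! a = k) (v a))"

text \<open>Boundaries have \<open>d = 0\<close>; a chain map that lifts multiplication by
  \<open>f\<close> has \<open>d\<close> equal to the degree of \<open>f\<close>.\<close>

definition graded_map ::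
  "nat set \<Rightarrow> nat \<Rightarrow> nat list \<Rightarrow> nat list \<Rightarrow> (nat \<Rightarrow> nat \<Rightarrow> 'a::field mpoly) \<Rightarrow> bool" where
  "graded_map V d s t A \<longleftrightarrow> (\<forall>a<length t. \<forall>b<length s. A a b \<in> polys V \<and>
     (\<forall>m\<in>Poly_Mapping.keys (A a b). mon_degree m + t ! a = s ! b + d))"

lemma graded_map_polys:
  "graded_map V d s t A \<Longrightarrow> a < length t \<Longrightarrow> b < length s \<Longrightarrow> A a b \<in> polys V"
  by (auto simp: graded_map_def)

lemma graded_map_free:
  assumes "graded_map V d s t A" "v \<in> free_module V (length s)"
  shows "mat_apply (length t) (length s) A v \<in> free_module V (length t)"
  by (rule mat_apply_free[OF _ assms(2)]) (rule graded_map_polys[OF assms(1)])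

text \<open>Each entry has the single degree that carries the component \<open>k\<close> in one
  summand to the component \<open>k + d\<close> in another, so \<open>restr_mult\<close> applies
  entrywise.\<close>

lemma vec_comp_mat_apply:
  assumes "graded_map V d s t A"
  shows "vec_comp t (k + d) (mat_apply (length t) (length s) A v)
       = mat_apply (length t) (length s) A (vec_comp s k v)"
proof
  fix a
  have "restr (\<lambda>m. mon_degree m + t ! a = k + d) (A a b * v b)
      = A a b * restr (\<lambda>m. mon_degree m + s ! b = k) (v b)"
    if "a < length t" "b < length s" for b
  proof (rule restr_mult)
    fix m m' assume "m \<in> Poly_Mapping.keys (A a b)"
    hence "mon_degree m + t ! a = s ! b + d" using assms that by (auto simp: graded_map_def)
    thus "(mon_degree (m + m') + t ! a = k + d) = (mon_degree m' + s ! b = k)"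
      by (auto simp: mon_degree_add)
  qed
  thus "vec_comp t (k + d) (mat_apply (length t) (length s) A v) a
       = mat_apply (length t) (length s) A (vec_comp s k v) a"
    by (auto simp: vec_comp_def mat_apply_def restr_sum intro!: sum.cong)
qed

lemma vec_comp_basis: "vec_comp s (s ! b) (basis b) = basis b"
  by (auto simp: vec_comp_def basis_def fun_eq_iff intro!: restr_id)

lemma vec_comp_free: "v \<in> free_module V r \<Longrightarrow> vec_comp t k v \<in> free_module V r"
  by (auto simp: free_module_def vec_comp_def)

text \<open>A complex is augmented here by the module \<open>R\<close> itself in position \<open>0\<close>, so that \<open>F\<^sub>i\<close> sits in
  position \<open>i + 1\<close>. The equations that hold in \<open>R/I\<close> rather than in \<open>R\<close> are read modulo
  \<open>target_ideal I i\<close>, which treats all positions alike.\<close>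

definition target_ideal :: "'a::field mpoly set \<Rightarrow> nat \<Rightarrow> 'a mpoly set" where
  "target_ideal I i = (if i = 0 then I else {0})"

abbreviation boundary ::
  "(nat \<Rightarrow> nat list) \<Rightarrow> (nat \<Rightarrow> nat \<Rightarrow> nat \<Rightarrow> 'a::field mpoly) \<Rightarrow> nat \<Rightarrow> (nat \<Rightarrow> 'a mpoly) \<Rightarrow> nat \<Rightarrow> 'a mpoly" where
  "boundary s D i \<equiv> mat_apply (length (s i)) (length (s (Suc i))) (D i)"

abbreviation chain_module :: "nat set \<Rightarrow> (nat \<Rightarrow> nat list) \<Rightarrow> nat \<Rightarrow> (nat \<Rightarrow> 'a::field mpoly) set" where
  "chain_module V s i \<equiv> free_module V (length (s i))"

text \<open>The third conjunct is surjectivity onto \<open>R/I\<close>. The fourth is exactness at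
  \<open>F_i\<close>; for \<open>i = 0\<close> the kernel is that of the map to \<open>R/I\<close>,
  read modulo \<open>I\<close>.\<close>

definition aug_resolution ::
  "nat set \<Rightarrow> 'a::field mpoly set \<Rightarrow> (nat \<Rightarrow> nat list) \<Rightarrow> (nat \<Rightarrow> nat \<Rightarrow> nat \<Rightarrow> 'a mpoly) \<Rightarrow> bool" where
  "aug_resolution V I s D \<longleftrightarrow> s 0 = [0] \<and> (\<forall>i. graded_map V 0 (s (Suc i)) (s i) (D i)) \<and>
     (\<forall>y\<in>chain_module V s 0. \<exists>w\<in>chain_module V s 1. \<forall>a. boundary s D 0 w a - y a \<in> I) \<and>
     (\<forall>i. \<forall>v\<in>chain_module V s (Suc i). (\<forall>a. boundary s D i v a \<in> target_ideal I i) \<longleftrightarrow>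
        (\<exists>w\<in>chain_module V s (Suc (Suc i)). v = boundary s D (Suc i) w))"

text \<open>In position 0 the condition is vacuous, since there every vector has to be
  lifted.\<close>

definition cycle ::
  "'a::field mpoly set \<Rightarrow> (nat \<Rightarrow> nat list) \<Rightarrow> (nat \<Rightarrow> nat \<Rightarrow> nat \<Rightarrow> 'a mpoly) \<Rightarrow> nat \<Rightarrow> (nat \<Rightarrow> 'a mpoly) \<Rightarrow> bool" where
  "cycle I s D i y \<longleftrightarrow> (\<forall>j a. i = Suc j \<longrightarrow> boundary s D j y a \<in> target_ideal I j)"

lemma homogeneous_target: "homogeneous_ideal V I \<Longrightarrow> homogeneous_ideal V (target_ideal I i)"
  by (auto simp: target_ideal_def homogeneous_ideal_zero)

lemma aug_resolution_graded: "aug_resolution V I s D \<Longrightarrow> graded_map V 0 (s (Suc i)) (s i) (D i)"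
  by (simp add: aug_resolution_def)

lemma aug_resolution_exact:
  "aug_resolution V I s D \<Longrightarrow> v \<in> chain_module V s (Suc i) \<Longrightarrow>
    (\<forall>a. boundary s D i v a \<in> target_ideal I i) \<longleftrightarrow>
        (\<exists>w\<in>chain_module V s (Suc (Suc i)). v = boundary s D (Suc i) w)"
  unfolding aug_resolution_def by blast

lemma boundary_free:
  "aug_resolution V I s D \<Longrightarrow> v \<in> chain_module V s (Suc i) \<Longrightarrow> boundary s D i v \<in> chain_module V s i"
  by (rule graded_map_free[OF aug_resolution_graded])

lemma boundary_cycle:
  assumes "aug_resolution V I s D" "v \<in> chain_module V s (Suc i)"
  shows "cycle I s D i (boundary s D i v)"
  unfolding cycle_def
proof (intro allI impI)
  fix j a assume "i = Suc j"
  thus "boundary s D j (boundary s D i v) a \<in> target_ideal I j"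
    using aug_resolution_exact[OF assms(1), of "boundary s D i v" j] boundary_free[OF assms(1), of v i] assms(2)
    by blast
qed

text \<open>Surjectivity onto \<open>R/I\<close> in position 0 and exactness in the later positions,
  put into one form so that the inductions below need no separate base case.\<close>

lemma cycle_lift:
  assumes F: "aug_resolution V I s D" and I: "homogeneous_ideal V I"
    and y: "y \<in> chain_module V s i" "cycle I s D i y"
  shows "\<exists>w\<in>chain_module V s (Suc i). \<forall>a. boundary s D i w a - y a \<in> target_ideal I i"
proof (cases i)
  case 0
  have "\<exists>w\<in>chain_module V s 1. \<forall>a. boundary s D 0 w a - y a \<in> I"
    using F y(1) 0 unfolding aug_resolution_def by blast
  thus ?thesis using 0 by (simp add: target_ideal_def)
next
  case (Suc j)
  then obtain w where "w \<in> chain_module V s (Suc i)" "y = boundary s D i w"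
    using aug_resolution_exact[OF F, of y j] y by (auto simp: cycle_def)
  thus ?thesis using hideal_zero[OF homogeneous_target[OF I]] by (intro bexI[of _ w]) auto
qed

text \<open>The degree \<open>k\<close> component of any lift is again a lift: boundaries commute
  with components, and the error stays in the homogeneous ideal.\<close>

lemma cycle_lift_homogeneous:
  assumes F: "aug_resolution V I s D" and I: "homogeneous_ideal V I"
    and y: "y \<in> chain_module V s i" "cycle I s D i y" "vec_comp (s i) k y = y"
  shows "\<exists>w\<in>chain_module V s (Suc i). vec_comp (s (Suc i)) k w = w \<and>
           (\<forall>a. boundary s D i w a - y a \<in> target_ideal I i)"
proof -
  from cycle_lift[OF F I y(1,2)] obtain w where w: "w \<in> chain_module V s (Suc i)"
    "\<And>a. boundary s D i w a - y a \<in> target_ideal I i" by blast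
  let ?w = "vec_comp (s (Suc i)) k w"
  have "boundary s D i ?w a - y a \<in> target_ideal I i" for a
  proof -
    have "boundary s D i ?w a - y a = vec_comp (s i) k (boundary s D i w) a - vec_comp (s i) k y a"
      using vec_comp_mat_apply[OF aug_resolution_graded[OF F], of i k w] y(3) by simp
    also have "\<dots> = restr (\<lambda>m. mon_degree m + s i ! a = k) (boundary s D i w a - y a)"
      by (simp add: vec_comp_def restr_diff)
    also have "\<dots> \<in> target_ideal I i"
      by (rule hideal_restr[OF homogeneous_target[OF I] w(2)])
    finally show ?thesis .
  qed
  moreover have "vec_comp (s (Suc i)) k ?w = ?w"
    by (auto simp: vec_comp_def fun_eq_iff lookup_restr intro!: poly_mapping_eqI)
  ultimately show ?thesis using vec_comp_free[OF w(1)] by blast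
qed

text \<open>The invariant that lets a chain map be extended by one position. Preservation of
  \<open>target_ideal\<close> says in position 0 that the map descends to \<open>R/I'\<close>, and
  above it is linearity at 0.\<close>

definition chain_map_at where
  "chain_map_at V d I' t E I s D i \<phi> \<longleftrightarrow> graded_map V d (t i) (s i) \<phi> \<and>
     (\<forall>y\<in>chain_module V t i.
        ((\<forall>a. y a \<in> target_ideal I' i) \<longrightarrow> (\<forall>a. mat_apply (length (s i)) (length (t i)) \<phi> y a \<in> target_ideal I i)) \<and>
        (cycle I' t E i y \<longrightarrow> cycle I s D i (mat_apply (length (s i)) (length (t i)) \<phi> y)))"

text \<open>The ring acts freely on basis vectors, so it suffices to lift the image of each one's
  boundary. That image is a homogeneous cycle, hence it has a homogeneous lift, which becomes a
  column of the new matrix.\<close>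

lemma chain_map_step:
  assumes F: "aug_resolution V I s D" and I: "homogeneous_ideal V I"
    and G: "aug_resolution V I' t E"
    and \<phi>: "chain_map_at V d I' t E I s D i \<phi>"
  shows "\<exists>\<phi>'. chain_map_at V d I' t E I s D (Suc i) \<phi>' \<and>
    (\<forall>v\<in>chain_module V t (Suc i). \<forall>a.
        boundary s D i (mat_apply (length (s (Suc i))) (length (t (Suc i))) \<phi>' v) a
        - mat_apply (length (s i)) (length (t i)) \<phi> (boundary t E i v) a \<in> target_ideal I i)"
proof -
  let ?f = "mat_apply (length (s i)) (length (t i)) \<phi>"
  let ?k = "\<lambda>b. t (Suc i) ! b + d"
  have \<phi>1: "graded_map V d (t i) (s i) \<phi>" using \<phi> by (simp add: chain_map_at_def)
  have "\<exists>w. b < length (t (Suc i)) \<longrightarrow> w \<in> chain_module V s (Suc i) \<and> vec_comp (s (Suc i)) (?k b) w = w \<and>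
       (\<forall>a. boundary s D i w a - ?f (boundary t E i (basis b)) a \<in> target_ideal I i)" for b
  proof (cases "b < length (t (Suc i))")
    case True
    let ?z = "boundary t E i (basis b)"
    have b: "basis b \<in> chain_module V t (Suc i)" using True by (rule basis_in_free)
    have z: "?z \<in> chain_module V t i" "cycle I' t E i ?z"
      using boundary_free[OF G b] boundary_cycle[OF G b] by auto
    have "vec_comp (t i) (t (Suc i) ! b) ?z = ?z"
      using vec_comp_mat_apply[OF aug_resolution_graded[OF G], of i "t (Suc i) ! b" "basis b"]
      by (simp add: vec_comp_basis)
    hence "vec_comp (s i) (?k b) (?f ?z) = ?f ?z"
      using vec_comp_mat_apply[OF \<phi>1, of "t (Suc i) ! b" ?z] by simp
    moreover have "?f ?z \<in> chain_module V s i" by (rule graded_map_free[OF \<phi>1 z(1)])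
    moreover have "cycle I s D i (?f ?z)" using \<phi> z by (auto simp: chain_map_at_def)
    ultimately show ?thesis using cycle_lift_homogeneous[OF F I] by blast
  qed auto
  then obtain w where w: "\<And>b. b < length (t (Suc i)) \<Longrightarrow> w b \<in> chain_module V s (Suc i)"
      "\<And>b. b < length (t (Suc i)) \<Longrightarrow> vec_comp (s (Suc i)) (?k b) (w b) = w b"
      "\<And>b a. b < length (t (Suc i)) \<Longrightarrow>
        boundary s D i (w b) a - ?f (boundary t E i (basis b)) a \<in> target_ideal I i"
    by metis
  define \<phi>' where "\<phi>' = (\<lambda>a b. w b a)"
  let ?f' = "mat_apply (length (s (Suc i))) (length (t (Suc i))) \<phi>'"
  have f'_basis: "?f' (basis b) = w b" if "b < length (t (Suc i))" for b
    using free_moduleD(2)[OF w(1)[OF that]] that by (auto simp: mat_apply_basis \<phi>'_def fun_eq_iff)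
  have gr: "graded_map V d (t (Suc i)) (s (Suc i)) \<phi>'"
    unfolding graded_map_def
  proof (intro allI impI conjI ballI)
    fix a b assume ab: "a < length (s (Suc i))" "b < length (t (Suc i))"
    show "\<phi>' a b \<in> polys V" using free_moduleD(1)[OF w(1)[OF ab(2)]] by (simp add: \<phi>'_def)
    fix m assume "m \<in> Poly_Mapping.keys (\<phi>' a b)"
    hence "m \<in> Poly_Mapping.keys (vec_comp (s (Suc i)) (?k b) (w b) a)"
      using w(2)[OF ab(2)] by (simp add: \<phi>'_def)
    thus "mon_degree m + s (Suc i) ! a = ?k b" by (auto simp: vec_comp_def keys_restr)
  qed
  have comm: "boundary s D i (?f' v) a - ?f (boundary t E i v) a \<in> target_ideal I i"
    if "v \<in> chain_module V t (Suc i)" for v a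
  proof (rule linear_in_ideal[OF homogeneous_target[OF I] _ that,
        where f = "\<lambda>v a. boundary s D i (?f' v) a - ?f (boundary t E i v) a"])
    show "linear_map (\<lambda>v a. boundary s D i (?f' v) a - ?f (boundary t E i v) a)"
      by (rule linear_diff[OF linear_compose[OF linear_mat_apply linear_mat_apply]
            linear_compose[OF linear_mat_apply linear_mat_apply]])
    fix b assume b: "b < length (t (Suc i))"
    show "boundary s D i (?f' (basis b)) a - ?f (boundary t E i (basis b)) a \<in> target_ideal I i"
      unfolding f'_basis[OF b] by (rule w(3)[OF b])
  qed
  have "chain_map_at V d I' t E I s D (Suc i) \<phi>'"
    unfolding chain_map_at_def
  proof (intro conjI ballI impI gr)
    fix y :: "nat \<Rightarrow> 'a mpoly"
    assume "\<forall>a. y a \<in> target_ideal I' (Suc i)"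
    hence "y = (\<lambda>_. 0)" by (auto simp: target_ideal_def)
    thus "\<forall>a. ?f' y a \<in> target_ideal I (Suc i)"
      by (simp add: linear_zero[OF linear_mat_apply] target_ideal_def)
  next
    fix y :: "nat \<Rightarrow> 'a mpoly"
    assume y: "y \<in> chain_module V t (Suc i)" "cycle I' t E (Suc i) y"
    have "\<forall>a. ?f (boundary t E i y) a \<in> target_ideal I i"
      using \<phi> y boundary_free[OF G y(1)] by (auto simp: chain_map_at_def cycle_def)
    thus "cycle I s D (Suc i) (?f' y)"
      using hideal_cong[OF homogeneous_target[OF I] comm[OF y(1)]] by (auto simp: cycle_def)
  qed
  thus ?thesis using comm by blast
qed

text \<open>The hypothesis on \<open>I'\<close> makes multiplication by \<open>f\<close> a
  well-defined map from \<open>R/I'\<close> to \<open>R/I\<close>; the chain map lifts it.\<close>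

lemma chain_map_exists:
  assumes F: "aug_resolution V I s D" and I: "homogeneous_ideal V I"
    and G: "aug_resolution V I' t E" and I': "homogeneous_ideal V I'"
    and f: "f \<in> polys V" "\<And>m. m \<in> Poly_Mapping.keys f \<Longrightarrow> mon_degree m = d"
      "\<And>r. r \<in> I' \<Longrightarrow> f * r \<in> I"
  obtains \<phi> where "\<phi> 0 = (\<lambda>_ _. f)" "\<And>i. graded_map V d (t i) (s i) (\<phi> i)"
    "\<And>i v a. v \<in> chain_module V t (Suc i) \<Longrightarrow>
        boundary s D i (mat_apply (length (s (Suc i))) (length (t (Suc i))) (\<phi> (Suc i)) v) a
        - mat_apply (length (s i)) (length (t i)) (\<phi> i) (boundary t E i v) a \<in> target_ideal I i"
proof -
  have s0: "s 0 = [0]" "t 0 = [0]" using F G by (auto simp: aug_resolution_def)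
  have base: "chain_map_at V d I' t E I s D 0 (\<lambda>_ _. f)"
    using f hideal_zero[OF I]
    by (auto simp: chain_map_at_def graded_map_def s0 target_ideal_def cycle_def mat_apply_def)
  define P where "P = (\<lambda>i \<phi>. chain_map_at V d I' t E I s D i \<phi> \<and> (i = 0 \<longrightarrow> \<phi> = (\<lambda>_ _. f)))"
  define Q where "Q = (\<lambda>i \<phi> \<phi>'. \<forall>v\<in>chain_module V t (Suc i). \<forall>a.
        boundary s D i (mat_apply (length (s (Suc i))) (length (t (Suc i))) \<phi>' v) a
        - mat_apply (length (s i)) (length (t i)) \<phi> (boundary t E i v) a \<in> target_ideal I i)"
  have "\<exists>\<phi>. \<forall>i. P i (\<phi> i) \<and> Q i (\<phi> i) (\<phi> (Suc i))"
  proof (rule dependent_nat_choice)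
    show "\<exists>\<phi>. P 0 \<phi>" using base by (auto simp: P_def)
    show "\<exists>\<phi>'. P (Suc i) \<phi>' \<and> Q i \<phi> \<phi>'" if "P i \<phi>" for i \<phi>
      using chain_map_step[OF F I G, of d i \<phi>] that by (simp add: P_def Q_def)
  qed
  then obtain \<phi> where \<phi>: "\<And>i. P i (\<phi> i)" "\<And>i. Q i (\<phi> i) (\<phi> (Suc i))" by blast
  show ?thesis
  proof (rule that)
    show "\<phi> 0 = (\<lambda>_ _. f)" using \<phi>(1)[of 0] by (simp add: P_def)
    show "graded_map V d (t i) (s i) (\<phi> i)" for i
      using \<phi>(1)[of i] by (simp add: P_def chain_map_at_def)
  qed (use \<phi>(2) in \<open>auto simp: Q_def\<close>)
qed

section \<open>Uniqueness of minimal shifts\<close>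

lemma mat_apply_in_ideal:
  assumes "homogeneous_ideal V J" "\<And>a b. a < r \<Longrightarrow> b < q \<Longrightarrow> A a b \<in> polys V" "\<And>b. y b \<in> J"
  shows "mat_apply r q A y a \<in> J"
  using assms(2,3)
  by (auto simp: mat_apply_def intro!: hideal_sum[OF assms(1)] hideal_mult[OF assms(1)] hideal_zero[OF assms(1)])

section \<open>Null-homotopies\<close>

abbreviation up_map ::
  "(nat \<Rightarrow> nat list) \<Rightarrow> nat \<Rightarrow> (nat \<Rightarrow> nat \<Rightarrow> 'a::field mpoly) \<Rightarrow> (nat \<Rightarrow> 'a mpoly) \<Rightarrow> nat \<Rightarrow> 'a mpoly" where
  "up_map s i h \<equiv> mat_apply (length (s (Suc i))) (length (s i)) h"

text \<open>The defect of \<open>\<theta>\<close> from the part of the homotopy already built is a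
  cycle, hence a boundary; its preimages of basis vectors are the columns of
  \<open>h'\<close>.\<close>

lemma chain_homotopy_step:
  assumes F: "aug_resolution V I s D" and I: "homogeneous_ideal V I"
    and \<theta>: "\<And>i. linear_map (\<theta> i)" "\<And>i v. v \<in> chain_module V s i \<Longrightarrow> \<theta> i v \<in> chain_module V s i"
    and comm: "\<And>i v a. v \<in> chain_module V s (Suc i) \<Longrightarrow>
      boundary s D i (\<theta> (Suc i) v) a - \<theta> i (boundary s D i v) a \<in> target_ideal I i"
    and h: "i = 0 \<longrightarrow> h = (\<lambda>_ _. 0)" "\<And>a b. a < length (s (Suc i)) \<Longrightarrow> b < length (s i) \<Longrightarrow> h a b \<in> polys V"
      "\<And>v. v \<in> chain_module V s (Suc i) \<Longrightarrow>
        cycle I s D (Suc i) (\<lambda>a. \<theta> (Suc i) v a - up_map s i h (boundary s D i v) a)"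
  shows "\<exists>h'. (\<forall>a<length (s (Suc (Suc i))). \<forall>b<length (s (Suc i)). h' a b \<in> polys V) \<and>
    (\<forall>v\<in>chain_module V s (Suc (Suc i)).
        cycle I s D (Suc (Suc i)) (\<lambda>a. \<theta> (Suc (Suc i)) v a - up_map s (Suc i) h' (boundary s D (Suc i) v) a)) \<and>
    (\<forall>v\<in>chain_module V s (Suc i). boundary s D (Suc i) (up_map s (Suc i) h' v)
        = (\<lambda>a. \<theta> (Suc i) v a - up_map s i h (boundary s D i v) a))"
proof -
  let ?z = "\<lambda>v a. \<theta> (Suc i) v a - up_map s i h (boundary s D i v) a"
  have lin: "linear_map (up_map s i h)" for i h by (rule linear_mat_apply)
  have linz: "linear_map ?z"
    by (rule linear_diff[OF \<theta>(1) linear_compose[OF lin linear_mat_apply]])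
  have "\<exists>w. b < length (s (Suc i)) \<longrightarrow> w \<in> chain_module V s (Suc (Suc i)) \<and>
          ?z (basis b) = boundary s D (Suc i) w" for b
  proof (cases "b < length (s (Suc i))")
    case True
    hence b: "basis b \<in> chain_module V s (Suc i)" by (rule basis_in_free)
    have "up_map s i h (boundary s D i (basis b)) \<in> chain_module V s (Suc i)"
      by (rule mat_apply_free[OF h(2) boundary_free[OF F b]])
    hence "?z (basis b) \<in> chain_module V s (Suc i)" by (rule free_module_diff[OF \<theta>(2)[OF b]])
    moreover have "\<forall>a. boundary s D i (?z (basis b)) a \<in> target_ideal I i"
      using h(3)[OF b] by (simp add: cycle_def)
    ultimately have "\<exists>w\<in>chain_module V s (Suc (Suc i)). ?z (basis b) = boundary s D (Suc i) w"
      using aug_resolution_exact[OF F] by blast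
    thus ?thesis by blast
  qed auto
  then obtain w where "\<And>b. b < length (s (Suc i)) \<longrightarrow> w b \<in> chain_module V s (Suc (Suc i)) \<and>
          ?z (basis b) = boundary s D (Suc i) (w b)"
    using choice[of "\<lambda>b w. b < length (s (Suc i)) \<longrightarrow> w \<in> chain_module V s (Suc (Suc i)) \<and>
          ?z (basis b) = boundary s D (Suc i) w"] by blast
  hence w: "\<And>b. b < length (s (Suc i)) \<Longrightarrow> w b \<in> chain_module V s (Suc (Suc i))"
      "\<And>b. b < length (s (Suc i)) \<Longrightarrow> ?z (basis b) = boundary s D (Suc i) (w b)"
    by blast+
  define h' where "h' = (\<lambda>a b. w b a)"
  have h'_basis: "up_map s (Suc i) h' (basis b) = w b" if "b < length (s (Suc i))" for b
    using free_moduleD(2)[OF w(1)[OF that]] that by (auto simp: mat_apply_basis h'_def fun_eq_iff)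
  have Q: "boundary s D (Suc i) (up_map s (Suc i) h' v) = ?z v" if "v \<in> chain_module V s (Suc i)" for v
  proof
    fix a
    have "boundary s D (Suc i) (up_map s (Suc i) h' v) a - ?z v a \<in> {0}"
    proof (rule linear_in_ideal[OF homogeneous_ideal_zero _ that,
          where f = "\<lambda>v a. boundary s D (Suc i) (up_map s (Suc i) h' v) a - ?z v a"])
      show "linear_map (\<lambda>v a. boundary s D (Suc i) (up_map s (Suc i) h' v) a - ?z v a)"
        by (rule linear_diff[OF linear_compose[OF linear_mat_apply lin] linz])
      fix b assume b: "b < length (s (Suc i))"
      show "boundary s D (Suc i) (up_map s (Suc i) h' (basis b)) a - ?z (basis b) a \<in> {0}"
        unfolding h'_basis[OF b] using fun_cong[OF w(2)[OF b], of a] by simp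
    qed
    thus "boundary s D (Suc i) (up_map s (Suc i) h' v) a = ?z v a" by simp
  qed
  have P: "cycle I s D (Suc (Suc i)) (\<lambda>a. \<theta> (Suc (Suc i)) v a - up_map s (Suc i) h' (boundary s D (Suc i) v) a)"
    if v: "v \<in> chain_module V s (Suc (Suc i))" for v
  proof -
    let ?u = "boundary s D (Suc i) v"
    have u: "?u \<in> chain_module V s (Suc i)" by (rule boundary_free[OF F v])
    have "\<forall>a. boundary s D i ?u a \<in> target_ideal I i"
      using aug_resolution_exact[OF F u] v by blast
    \<comment> \<open>For \<open>i = 0\<close> the double boundary lies in \<open>I\<close> but may
      be nonzero. This is why the homotopy has to start with the zero map.\<close>
    hence "up_map s i h (boundary s D i ?u) = (\<lambda>_. 0)"
    proof (cases i)
      case 0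
      thus ?thesis using h(1) by (auto simp: mat_apply_def[of _ _ "\<lambda>_ _. 0"])
    next
      case (Suc j)
      assume "\<forall>a. boundary s D i ?u a \<in> target_ideal I i"
      hence "boundary s D i ?u = (\<lambda>_. 0)" using Suc by (auto simp: target_ideal_def)
      thus ?thesis by (simp add: linear_zero[OF lin])
    qed
    hence "boundary s D (Suc i) (up_map s (Suc i) h' ?u) = \<theta> (Suc i) ?u"
      using Q[OF u] by simp
    moreover have "boundary s D (Suc i) (\<theta> (Suc (Suc i)) v) a = \<theta> (Suc i) ?u a" for a
      using comm[OF v, of a] by (simp add: target_ideal_def)
    ultimately show ?thesis
      by (simp add: cycle_def linear_sub[OF linear_mat_apply] target_ideal_def)
  qed
  have "h' a b \<in> polys V" if "b < length (s (Suc i))" for a b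
    using free_moduleD(1)[OF w(1)[OF that]] by (simp add: h'_def)
  thus ?thesis using P Q by (intro exI[of _ h']) blast
qed

lemma chain_homotopy_exists:
  assumes F: "aug_resolution V I s D" and I: "homogeneous_ideal V I"
    and \<theta>: "\<And>i. linear_map (\<theta> i)" "\<And>i v. v \<in> chain_module V s i \<Longrightarrow> \<theta> i v \<in> chain_module V s i"
    and \<theta>0: "\<And>v. v \<in> chain_module V s 0 \<Longrightarrow> \<theta> 0 v = (\<lambda>_. 0)"
    and comm: "\<And>i v a. v \<in> chain_module V s (Suc i) \<Longrightarrow>
      boundary s D i (\<theta> (Suc i) v) a - \<theta> i (boundary s D i v) a \<in> target_ideal I i"
  shows "\<exists>h. h 0 = (\<lambda>_ _. 0) \<and> (\<forall>i v. v \<in> chain_module V s (Suc i) \<longrightarrow>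
      \<theta> (Suc i) v = (\<lambda>a. boundary s D (Suc i) (up_map s (Suc i) (h (Suc i)) v) a + up_map s i (h i) (boundary s D i v) a))"
proof -
  define P where "P = (\<lambda>i h. (i = 0 \<longrightarrow> h = (\<lambda>_ _. 0)) \<and>
      (\<forall>a<length (s (Suc i)). \<forall>b<length (s i). h a b \<in> polys V) \<and>
      (\<forall>v\<in>chain_module V s (Suc i).
        cycle I s D (Suc i) (\<lambda>a. \<theta> (Suc i) v a - up_map s i h (boundary s D i v) a)))"
  define Q where "Q = (\<lambda>i h h'. \<forall>v\<in>chain_module V s (Suc i). boundary s D (Suc i) (up_map s (Suc i) h' v)
        = (\<lambda>a. \<theta> (Suc i) v a - up_map s i h (boundary s D i v) a))"
  have "\<exists>h. \<forall>i. P i (h i) \<and> Q i (h i) (h (Suc i))"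
  proof (rule dependent_nat_choice)
    have H0: "up_map s i (\<lambda>_ _. 0) v a = 0" for i v a by (simp add: mat_apply_def)
    have "boundary s D 0 (\<theta> (Suc 0) v) a \<in> target_ideal I 0" if v: "v \<in> chain_module V s (Suc 0)" for v a
      using comm[OF v, of a] \<theta>0[OF boundary_free[OF F v]] by simp
    hence "P 0 (\<lambda>_ _. 0)" by (simp add: P_def cycle_def H0)
    thus "\<exists>h. P 0 h" by blast
    show "\<exists>h'. P (Suc i) h' \<and> Q i h h'" if "P i h" for i h
      using chain_homotopy_step[OF F I \<theta> comm, of i h] that unfolding P_def Q_def by simp
  qed
  then obtain h where h: "\<And>i. P i (h i)" "\<And>i. Q i (h i) (h (Suc i))" by blast
  show ?thesis
  proof (intro exI[of _ h] conjI allI impI)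
    show "h 0 = (\<lambda>_ _. 0)" using h(1)[of 0] by (simp add: P_def)
    show "\<theta> (Suc i) v = (\<lambda>a. boundary s D (Suc i) (up_map s (Suc i) (h (Suc i)) v) a + up_map s i (h i) (boundary s D i v) a)"
      if "v \<in> chain_module V s (Suc i)" for i v
      using h(2)[of i] that by (simp add: Q_def)
  qed
qed

section \<open>Linear algebra over the coefficient field\<close>

lemma underdetermined_system:
  fixes P :: "'b \<Rightarrow> 'c \<Rightarrow> 'a::field"
  assumes "finite B" "finite A" "card B < card A"
  shows "\<exists>x. (\<exists>a\<in>A. x a \<noteq> 0) \<and> (\<forall>b\<in>B. (\<Sum>a\<in>A. P b a * x a) = 0)"
  using assms
proof (induction B arbitrary: A P rule: finite_induct)
  case empty
  hence "A \<noteq> {}" by auto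
  thus ?case by (intro exI[of _ "\<lambda>_. 1"]) auto
next
  case (insert b B)
  show ?case
  proof (cases "\<forall>a\<in>A. P b a = 0")
    case True
    have "card B < card A" using insert by simp
    from insert.IH[OF insert.prems(1) this, of P] True show ?thesis by auto
  next
    case False
    then obtain a0 where a0: "a0 \<in> A" "P b a0 \<noteq> 0" by blast
    let ?A = "A - {a0}"
    have "finite ?A" "card B < card ?A" using insert a0 by auto
    \<comment> \<open>Gaussian elimination: equation \<open>b\<close> is solved for the unknown at
      the pivot \<open>a0\<close> and substituted into the others.\<close>
    from insert.IH[OF this, of "\<lambda>c a. P c a - P c a0 * P b a / P b a0"] obtain x where
      x: "\<exists>a\<in>?A. x a \<noteq> 0" "\<forall>c\<in>B. (\<Sum>a\<in>?A. (P c a - P c a0 * P b a / P b a0) * x a) = 0"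
      by blast
    \<comment> \<open>Back substitution: the value at \<open>a0\<close> is the one forced by
      equation \<open>b\<close>.\<close>
    define y where "y = x(a0 := - (\<Sum>a\<in>?A. P b a * x a) / P b a0)"
    have sum_y: "(\<Sum>a\<in>A. P c a * y a) = P c a0 * y a0 + (\<Sum>a\<in>?A. P c a * x a)" for c
      using a0 insert.prems(1) by (subst sum.remove[of A a0]) (auto simp: y_def intro!: sum.cong)
    have "(\<Sum>a\<in>A. P c a * y a) = 0" if "c \<in> insert b B" for c
    proof (cases "c = b")
      case True
      thus ?thesis unfolding sum_y using a0 by (simp add: y_def)
    next
      case False
      hence "(\<Sum>a\<in>?A. (P c a - P c a0 * P b a / P b a0) * x a) = 0" using x that by blast
      also have "(\<Sum>a\<in>?A. (P c a - P c a0 * P b a / P b a0) * x a)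
        = (\<Sum>a\<in>?A. P c a * x a) - P c a0 / P b a0 * (\<Sum>a\<in>?A. P b a * x a)"
        by (simp add: algebra_simps sum_subtractf sum_distrib_left)
      finally show ?thesis unfolding sum_y by (simp add: y_def)
    qed
    moreover have "\<exists>a\<in>A. y a \<noteq> 0" using x(1) by (auto simp: y_def)
    ultimately show ?thesis by blast
  qed
qed

lemma count_list_conv_card: "count_list xs j = card {a. a < length xs \<and> xs ! a = j}"
  by (simp add: count_list_eq_length_filter length_filter_conv_card eq_commute)

text \<open>\<open>P\<close> is block diagonal with respect to degrees. If its block of degree
  \<open>j\<close> had more columns than rows, it would kill a nonzero vector, which a left inverse
  forbids.\<close>

lemma count_list_le_of_left_inverse:
  fixes P Q :: "nat \<Rightarrow> nat \<Rightarrow> 'a::field"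
  assumes inv: "\<And>a a'. a < length s \<Longrightarrow> a' < length s \<Longrightarrow>
      (\<Sum>b<length t. Q a b * P b a') = (if a = a' then 1 else 0)"
    and P: "\<And>a b. a < length s \<Longrightarrow> b < length t \<Longrightarrow> P b a \<noteq> 0 \<Longrightarrow> t ! b = s ! a"
  shows "count_list s j \<le> count_list t j"
proof (rule ccontr)
  let ?A = "{a. a < length s \<and> s ! a = j}" and ?B = "{b. b < length t \<and> t ! b = j}"
  assume "\<not> count_list s j \<le> count_list t j"
  hence "card ?B < card ?A" by (simp add: count_list_conv_card)
  from underdetermined_system[OF _ _ this, of P] obtain x a0 where
    x: "a0 \<in> ?A" "x a0 \<noteq> 0" "\<forall>b\<in>?B. (\<Sum>a\<in>?A. P b a * x a) = 0" by auto
  \<comment> \<open>Rows of another degree vanish on the block, so the vector found for the rows of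
    degree \<open>j\<close> is killed by every row.\<close>
  have 0: "(\<Sum>a\<in>?A. P b a * x a) = 0" if "b < length t" for b
  proof (cases "b \<in> ?B")
    case False
    thus ?thesis using P that by (intro sum.neutral) auto
  qed (use x in blast)
  have "x a0 = (\<Sum>a\<in>?A. if a0 = a then x a else 0)"
    using x(1) by simp
  also have "\<dots> = (\<Sum>a\<in>?A. (\<Sum>b<length t. Q a0 b * P b a) * x a)"
    by (rule sum.cong) (use inv x(1) in auto)
  also have "\<dots> = (\<Sum>b<length t. Q a0 b * (\<Sum>a\<in>?A. P b a * x a))"
    by (simp add: sum_distrib_left sum_distrib_right mult.assoc) (rule sum.swap)
  also have "\<dots> = 0" using 0 by simp
  finally show False using x(2) by simp
qed

text \<open>The indices start at \<open>D 1\<close>: \<open>D 0\<close> is the augmentation, which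
  has constant entries when \<open>R\<close> maps onto \<open>R/I\<close> by the identity.
  \<open>irrelevant_ideal_iff\<close> links this form to the irrelevant ideal.\<close>

definition minimal_complex :: "(nat \<Rightarrow> nat list) \<Rightarrow> (nat \<Rightarrow> nat \<Rightarrow> nat \<Rightarrow> 'a::field mpoly) \<Rightarrow> bool" where
  "minimal_complex s D \<longleftrightarrow> (\<forall>i. \<forall>a<length (s (Suc i)). \<forall>b<length (s (Suc (Suc i))).
      Poly_Mapping.lookup (D (Suc i) a b) 0 = 0)"

lemma const_coeff_mat_apply:
  "Poly_Mapping.lookup (mat_apply r q A v a) 0
    = (if a < r then \<Sum>b<q. Poly_Mapping.lookup (A a b) 0 * Poly_Mapping.lookup (v b) 0 else 0)"
  by (simp add: mat_apply_def lookup_sum const_coeff_mult)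

lemma minimal_boundary_const_coeff:
  "minimal_complex s D \<Longrightarrow> Poly_Mapping.lookup (boundary s D (Suc i) v a) 0 = 0"
  by (auto simp: const_coeff_mat_apply minimal_complex_def)

text \<open>Write \<open>\<theta>\<close> for \<open>\<psi>\<close> after \<open>\<phi>\<close>
  minus the identity. It is null-homotopic, and minimality of \<open>s\<close> makes the homotopy
  formula vanish modulo the irrelevant ideal. So the constant part of \<open>\<psi>\<close> is a
  left inverse of that of \<open>\<phi>\<close>, and homogeneity confines constants to equal
  degrees.\<close>

lemma minimal_shifts_le:
  fixes I :: "'a::field mpoly set"
  assumes I: "homogeneous_ideal V I"
    and F: "aug_resolution V I s D" "minimal_complex s D"
    and G: "aug_resolution V I t E"
  shows "count_list (s (Suc i)) j \<le> count_list (t (Suc i)) j"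
proof -
  have one: "(1 :: 'a mpoly) \<in> polys V" "\<And>m. m \<in> Poly_Mapping.keys (1 :: 'a mpoly) \<Longrightarrow> mon_degree m = 0"
     "\<And>r. r \<in> I \<Longrightarrow> 1 * r \<in> I" by auto
  obtain \<phi> where \<phi>: "\<phi> 0 = (\<lambda>_ _. 1)" "\<And>i. graded_map V 0 (s i) (t i) (\<phi> i)"
    "\<And>i v a. v \<in> chain_module V s (Suc i) \<Longrightarrow>
        boundary t E i (mat_apply (length (t (Suc i))) (length (s (Suc i))) (\<phi> (Suc i)) v) a
        - mat_apply (length (t i)) (length (s i)) (\<phi> i) (boundary s D i v) a \<in> target_ideal I i"
    using chain_map_exists[OF G I F(1) I one] by blast
  obtain \<psi> where \<psi>: "\<psi> 0 = (\<lambda>_ _. 1)" "\<And>i. graded_map V 0 (t i) (s i) (\<psi> i)"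
    "\<And>i v a. v \<in> chain_module V t (Suc i) \<Longrightarrow>
        boundary s D i (mat_apply (length (s (Suc i))) (length (t (Suc i))) (\<psi> (Suc i)) v) a
        - mat_apply (length (s i)) (length (t i)) (\<psi> i) (boundary t E i v) a \<in> target_ideal I i"
    using chain_map_exists[OF F(1) I G I one] by blast
  let ?f = "\<lambda>i. mat_apply (length (t i)) (length (s i)) (\<phi> i)"
  let ?g = "\<lambda>i. mat_apply (length (s i)) (length (t i)) (\<psi> i)"
  define \<theta> where "\<theta> = (\<lambda>i v a. ?g i (?f i v) a - v a)"
  have lin: "linear_map (\<theta> i)" for i
    unfolding \<theta>_def by (rule linear_diff[OF linear_compose[OF linear_mat_apply linear_mat_apply] linear_id])
  have free: "\<theta> i v \<in> chain_module V s i" if "v \<in> chain_module V s i" for i v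
    unfolding \<theta>_def by (intro free_module_diff graded_map_free[OF \<psi>(2)] graded_map_free[OF \<phi>(2)] that)
  have s0: "s 0 = [0]" "t 0 = [0]" using F G by (auto simp: aug_resolution_def)
  have \<theta>0: "\<theta> 0 v = (\<lambda>_. 0)" if "v \<in> chain_module V s 0" for v
    using free_moduleD(2)[OF that] by (auto simp: \<theta>_def \<phi>(1) \<psi>(1) s0 mat_apply_def fun_eq_iff)
  have comm: "boundary s D i (\<theta> (Suc i) v) a - \<theta> i (boundary s D i v) a \<in> target_ideal I i"
    if v: "v \<in> chain_module V s (Suc i)" for i v a
  proof -
    let ?T = "target_ideal I i"
    have T: "homogeneous_ideal V ?T" by (rule homogeneous_target[OF I])
    have "boundary s D i (?g (Suc i) (?f (Suc i) v)) a - ?g i (boundary t E i (?f (Suc i) v)) a \<in> ?T"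
      by (rule \<psi>(3)[OF graded_map_free[OF \<phi>(2) v]])
    \<comment> \<open>The commutation error of \<open>\<phi>\<close> is pushed through
      \<open>\<psi> i\<close>, which keeps it in the ideal, and is added to that of
      \<open>\<psi>\<close>.\<close>
    moreover have "?g i (\<lambda>a. boundary t E i (?f (Suc i) v) a - ?f i (boundary s D i v) a) a \<in> ?T"
      by (rule mat_apply_in_ideal[OF T graded_map_polys[OF \<psi>(2)] \<phi>(3)[OF v]])
    ultimately have "(boundary s D i (?g (Suc i) (?f (Suc i) v)) a - ?g i (boundary t E i (?f (Suc i) v)) a)
       + ?g i (\<lambda>a. boundary t E i (?f (Suc i) v) a - ?f i (boundary s D i v) a) a \<in> ?T"
      by (rule hideal_add[OF T])
    thus ?thesis by (simp add: \<theta>_def linear_sub[OF linear_mat_apply])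
  qed
  have "\<exists>h. h 0 = (\<lambda>_ _. 0) \<and> (\<forall>i v. v \<in> chain_module V s (Suc i) \<longrightarrow>
      \<theta> (Suc i) v = (\<lambda>a. boundary s D (Suc i) (up_map s (Suc i) (h (Suc i)) v) a + up_map s i (h i) (boundary s D i v) a))"
    by (rule chain_homotopy_exists[OF F(1) I lin free \<theta>0 comm])
  then obtain h where "h 0 = (\<lambda>_ _. 0) \<and> (\<forall>i v. v \<in> chain_module V s (Suc i) \<longrightarrow>
      \<theta> (Suc i) v = (\<lambda>a. boundary s D (Suc i) (up_map s (Suc i) (h (Suc i)) v) a + up_map s i (h i) (boundary s D i v) a))" ..
  note h = conjunct1[OF this] conjunct2[OF this, rule_format]
  have h_const: "Poly_Mapping.lookup (mat_apply (length (s (Suc i))) (length (s i)) (h i) (boundary s D i v) a) 0 = 0"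
    for v a i
  proof (cases i)
    \<comment> \<open>The augmentation may have constant entries, so here the vanishing comes from
      \<open>h 0 = 0\<close> instead of minimality.\<close>
    case 0
    thus ?thesis by (simp add: h(1) mat_apply_def)
  next
    case (Suc j)
    thus ?thesis unfolding const_coeff_mat_apply[of _ _ "h i"] by (simp only: minimal_boundary_const_coeff[OF F(2)] mult_zero_right sum.neutral_const if_cancel)
  qed
  show ?thesis
  proof (rule count_list_le_of_left_inverse[where
        Q = "\<lambda>a b. Poly_Mapping.lookup (\<psi> (Suc i) a b) 0" and P = "\<lambda>b a. Poly_Mapping.lookup (\<phi> (Suc i) b a) 0"])
    fix a a' assume a: "a < length (s (Suc i))" "a' < length (s (Suc i))"
    have "Poly_Mapping.lookup (\<theta> (Suc i) (basis a') a) 0 = 0"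
      unfolding h(2)[OF basis_in_free[OF a(2)]]
      by (simp only: lookup_add h_const minimal_boundary_const_coeff[OF F(2)] add_0_left)
    hence "Poly_Mapping.lookup (?g (Suc i) (?f (Suc i) (basis a')) a) 0
         = Poly_Mapping.lookup (basis a' a :: 'a mpoly) 0"
      by (simp add: \<theta>_def lookup_minus)
    also have "\<dots> = (if a = a' then 1 else 0)" by (simp add: basis_def)
    finally show "(\<Sum>b<length (t (Suc i)). Poly_Mapping.lookup (\<psi> (Suc i) a b) 0 * Poly_Mapping.lookup (\<phi> (Suc i) b a') 0)
          = (if a = a' then 1 else 0)"
      using a by (simp add: const_coeff_mat_apply mat_apply_basis)
  next
    fix a b assume ab: "a < length (s (Suc i))" "b < length (t (Suc i))"
      "Poly_Mapping.lookup (\<phi> (Suc i) b a) 0 \<noteq> 0"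
    hence "0 \<in> Poly_Mapping.keys (\<phi> (Suc i) b a)" by (simp add: in_keys_iff)
    hence "mon_degree 0 + t (Suc i) ! b = s (Suc i) ! a + 0"
      using \<phi>(2)[of "Suc i"] ab(1,2) unfolding graded_map_def by blast
    thus "t (Suc i) ! b = s (Suc i) ! a" by simp
  qed
qed

lemma minimal_shifts_unique:
  assumes "homogeneous_ideal V I"
    and "aug_resolution V I s D" "minimal_complex s D" "aug_resolution V I t E" "minimal_complex t E"
  shows "count_list (s (Suc i)) j = count_list (t (Suc i)) j"
  by (rule antisym[OF minimal_shifts_le[OF assms(1-4)] minimal_shifts_le[OF assms(1,4,5,2)]])

section \<open>Mapping cones\<close>

definition join_vec :: "nat \<Rightarrow> (nat \<Rightarrow> 'a) \<Rightarrow> (nat \<Rightarrow> 'a) \<Rightarrow> nat \<Rightarrow> 'a" where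
  "join_vec p x y = (\<lambda>a. if a < p then x a else y (a - p))"

definition block_mat ::
  "nat \<Rightarrow> nat \<Rightarrow> (nat \<Rightarrow> nat \<Rightarrow> 'a::zero) \<Rightarrow> (nat \<Rightarrow> nat \<Rightarrow> 'a) \<Rightarrow> (nat \<Rightarrow> nat \<Rightarrow> 'a) \<Rightarrow> nat \<Rightarrow> nat \<Rightarrow> 'a" where
  "block_mat p q A B C = (\<lambda>a b. if a < p then (if b < q then A a b else B a (b - q))
     else (if b < q then 0 else C (a - p) (b - q)))"

lemma sum_lessThan_add:
  "(\<Sum>b<q + q'. g b) = (\<Sum>b<q. g b) + (\<Sum>b<q'. g (q + b) :: 'a::comm_monoid_add)" for q q' :: nat
  by (induction q') (auto simp: add.assoc)

lemma mat_apply_block: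
  "mat_apply (p + p') (q + q') (block_mat p q A B C) v =
     (\<lambda>a. if a < p then mat_apply p q A v a + mat_apply p q' B (\<lambda>b. v (q + b)) a
          else mat_apply p' q' C (\<lambda>b. v (q + b)) (a - p))"
  by (auto simp: mat_apply_def block_mat_def sum_lessThan_add fun_eq_iff)

lemma mat_apply_cong: "(\<And>b. b < q \<Longrightarrow> v b = w b) \<Longrightarrow> mat_apply r q A v = mat_apply r q A w"
  by (auto simp: mat_apply_def fun_eq_iff intro!: sum.cong)

lemma mat_apply_outside: "a \<ge> r \<Longrightarrow> mat_apply r q A v a = 0"
  by (simp add: mat_apply_def)

lemma mat_apply_neg: "mat_apply r q (\<lambda>a b. - A a b) v a = - mat_apply r q A v a"
  by (simp add: mat_apply_def sum_negf)

text \<open>In position \<open>j + 1\<close> the cone is the sum of position \<open>j + 1\<close> of the first and position \<open>j\<close> of the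
  second complex, without the augmenting copy of \<open>R\<close> of the latter.\<close>

definition cone_shifts :: "nat \<Rightarrow> (nat \<Rightarrow> nat list) \<Rightarrow> (nat \<Rightarrow> nat list) \<Rightarrow> nat \<Rightarrow> nat list" where
  "cone_shifts d s t i = (case i of 0 \<Rightarrow> s 0
     | Suc j \<Rightarrow> s (Suc j) @ (if j = 0 then [] else map (\<lambda>x. x + d) (t j)))"

text \<open>The sign on \<open>E\<close> makes consecutive matrices compose to zero, because
  \<open>\<phi>\<close> commutes with the boundaries. For \<open>j = 0\<close> the rows of
  \<open>E 0\<close> fall outside the matrix, as the augmenting copy of \<open>R\<close> is absent
  from the cone.\<close>

definition cone_diff where
  "cone_diff s D E \<phi> i = (case i of 0 \<Rightarrow> D 0
     | Suc j \<Rightarrow> block_mat (length (s (Suc j))) (length (s (Suc (Suc j)))) (D (Suc j)) (\<phi> (Suc j)) (\<lambda>a b. - E j a b))"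

text \<open>The setting is the exact sequence \<open>0 -> R/I'(-d) -> R/I -> R/I'' -> 0\<close>
  whose first map is multiplication by \<open>f\<close>: \<open>I'\<close> is the colon ideal of
  \<open>I\<close> by \<open>f\<close>, which gives injectivity, and \<open>I''\<close> is
  \<open>I\<close> plus the principal ideal of \<open>f\<close>.\<close>

locale mapping_cone =
  fixes V :: "nat set" and I I' I'' :: "'a::field mpoly set"
    and s t :: "nat \<Rightarrow> nat list" and D E \<phi> :: "nat \<Rightarrow> nat \<Rightarrow> nat \<Rightarrow> 'a mpoly"
    and f :: "'a mpoly" and d :: nat
  assumes F: "aug_resolution V I s D" and I: "homogeneous_ideal V I"
    and G: "aug_resolution V I' t E" and I': "homogeneous_ideal V I'"
    and f: "f \<in> polys V"
    and colon: "\<And>r. r \<in> polys V \<Longrightarrow> r \<in> I' \<longleftrightarrow> f * r \<in> I"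
    and I'': "I'' = {g + f * r | g r. g \<in> I \<and> r \<in> polys V}"
    and \<phi>0: "\<phi> 0 = (\<lambda>_ _. f)"
    and \<phi>_graded: "\<And>i. graded_map V d (t i) (s i) (\<phi> i)"
    and \<phi>_comm: "\<And>i v a. v \<in> chain_module V t (Suc i) \<Longrightarrow>
        boundary s D i (mat_apply (length (s (Suc i))) (length (t (Suc i))) (\<phi> (Suc i)) v) a
        - mat_apply (length (s i)) (length (t i)) (\<phi> i) (boundary t E i v) a \<in> target_ideal I i"
begin

abbreviation "c \<equiv> cone_shifts d s t"
abbreviation "K \<equiv> cone_diff s D E \<phi>"
abbreviation "\<Phi> i \<equiv> mat_apply (length (s i)) (length (t i)) (\<phi> i)"

lemma c_simps: "c 0 = s 0" "c (Suc 0) = s (Suc 0)"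
  "c (Suc (Suc j)) = s (Suc (Suc j)) @ map (\<lambda>x. x + d) (t (Suc j))"
  by (simp_all add: cone_shifts_def)

lemma length_c: "length (c (Suc j)) = length (s (Suc j)) + (if j = 0 then 0 else length (t j))"
  by (simp add: cone_shifts_def)

lemma boundary_0: "boundary c K 0 = boundary s D 0"
  by (simp add: c_simps cone_diff_def)

lemma boundary_Suc:
  "boundary c K (Suc j) v = join_vec (length (s (Suc j)))
     (\<lambda>a. boundary s D (Suc j) v a + \<Phi> (Suc j) (\<lambda>b. v (length (s (Suc (Suc j))) + b)) a)
     (\<lambda>a. if j = 0 then 0 else - boundary t E j (\<lambda>b. v (length (s (Suc (Suc j))) + b)) a)"
proof -
  have K: "K (Suc j) = block_mat (length (s (Suc j))) (length (s (Suc (Suc j)))) (D (Suc j)) (\<phi> (Suc j)) (\<lambda>a b. - E j a b)"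
    by (simp add: cone_diff_def)
  have l: "length (c (Suc (Suc j))) = length (s (Suc (Suc j))) + length (t (Suc j))"
    by (simp add: length_c)
  show ?thesis unfolding K l length_c[of j] mat_apply_block join_vec_def
    by (auto simp: fun_eq_iff mat_apply_neg mat_apply_outside)
qed

lemma graded_cone: "graded_map V 0 (c (Suc i)) (c i) (K i)"
proof (cases i)
  case 0
  thus ?thesis using aug_resolution_graded[OF F, of 0] by (simp add: c_simps cone_diff_def)
next
  case (Suc j)
  let ?p = "length (s (Suc j))" and ?q = "length (s (Suc (Suc j)))"
  have c2: "c (Suc (Suc j)) = s (Suc (Suc j)) @ map (\<lambda>x. x + d) (t (Suc j))"
    by (rule c_simps)
  have c1: "c (Suc j) = s (Suc j) @ (if j = 0 then [] else map (\<lambda>x. x + d) (t j))"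
    by (simp add: cone_shifts_def)
  have "K (Suc j) a b \<in> polys V \<and>
     (\<forall>m\<in>Poly_Mapping.keys (K (Suc j) a b). mon_degree m + c (Suc j) ! a = c (Suc (Suc j)) ! b + 0)"
    if ab: "a < length (c (Suc j))" "b < length (c (Suc (Suc j)))" for a b
  proof -
    consider "a < ?p" "b < ?q" | "a < ?p" "b \<ge> ?q" | "a \<ge> ?p" "b < ?q" | "a \<ge> ?p" "b \<ge> ?q" by linarith
    thus ?thesis
    proof cases
      case 1
      have "K (Suc j) a b = D (Suc j) a b" using 1 by (simp add: cone_diff_def block_mat_def)
      moreover have "c (Suc j) ! a = s (Suc j) ! a" "c (Suc (Suc j)) ! b = s (Suc (Suc j)) ! b"
        using 1 by (simp_all add: c1 c2 nth_append)
      ultimately show ?thesis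
        using aug_resolution_graded[OF F, of "Suc j"] 1 by (simp add: graded_map_def)
    next
      case 2
      have b: "b - ?q < length (t (Suc j))" using ab 2 by (simp add: c2)
      have "K (Suc j) a b = \<phi> (Suc j) a (b - ?q)" using 2 by (simp add: cone_diff_def block_mat_def)
      moreover have "c (Suc j) ! a = s (Suc j) ! a" "c (Suc (Suc j)) ! b = t (Suc j) ! (b - ?q) + d"
        using 2 b by (simp_all add: c1 c2 nth_append)
      ultimately show ?thesis
        using \<phi>_graded[of "Suc j"] 2 b by (simp add: graded_map_def)
    next
      case 3
      hence "K (Suc j) a b = 0" by (simp add: cone_diff_def block_mat_def)
      thus ?thesis by simp
    next
      case 4
      have b: "b - ?q < length (t (Suc j))" using ab 4 by (simp add: c2)
      have j: "j \<noteq> 0" using ab 4 by (auto simp: c1 split: if_splits)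
      have a: "a - ?p < length (t j)" using ab 4 j by (simp add: c1)
      have "K (Suc j) a b = - E j (a - ?p) (b - ?q)" using 4 by (simp add: cone_diff_def block_mat_def)
      moreover have "c (Suc j) ! a = t j ! (a - ?p) + d" "c (Suc (Suc j)) ! b = t (Suc j) ! (b - ?q) + d"
        using 4 a b j by (simp_all add: c1 c2 nth_append)
      ultimately show ?thesis
        using aug_resolution_graded[OF G, of j] a b by (auto simp: graded_map_def)
    qed
  qed
  thus ?thesis unfolding Suc graded_map_def by blast
qed

lemma boundary_boundary:
  assumes "w \<in> chain_module V s (Suc (Suc j))"
  shows "boundary s D j (boundary s D (Suc j) w) a \<in> target_ideal I j"
  using aug_resolution_exact[OF F boundary_free[OF F assms]] assms by blast

lemma boundary_join:
  assumes "w \<in> chain_module V s (Suc (Suc j))"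
  shows "boundary c K (Suc j) (join_vec (length (s (Suc (Suc j)))) w z) = join_vec (length (s (Suc j)))
     (\<lambda>a. boundary s D (Suc j) w a + \<Phi> (Suc j) z a) (\<lambda>a. if j = 0 then 0 else - boundary t E j z a)"
proof -
  have "boundary s D (Suc j) (join_vec (length (s (Suc (Suc j)))) w z) = boundary s D (Suc j) w"
    by (rule mat_apply_cong) (simp add: join_vec_def)
  moreover have "(\<lambda>b. join_vec (length (s (Suc (Suc j)))) w z (length (s (Suc (Suc j))) + b)) = z"
    by (simp add: join_vec_def)
  ultimately show ?thesis unfolding boundary_Suc by (simp cong: if_cong)
qed

lemma join_free:
  assumes "w \<in> chain_module V s (Suc (Suc j))" "z \<in> chain_module V t (Suc j)"
  shows "join_vec (length (s (Suc (Suc j)))) w z \<in> chain_module V c (Suc (Suc j))"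
  using assms by (auto simp: free_module_def join_vec_def c_simps)

text \<open>If the boundary of \<open>v\<close> is \<open>g + f * r\<close>, a lift \<open>z\<close>
  of \<open>r\<close> in the second complex corrects \<open>v\<close> by its image under
  \<open>\<Phi>\<close>. The boundary of the corrected vector lies in \<open>I\<close>, where
  exactness of the first complex applies.\<close>

lemma exact_0:
  assumes v: "v \<in> chain_module V c (Suc 0)"
  shows "(\<forall>a. boundary c K 0 v a \<in> I'') \<longleftrightarrow> (\<exists>w\<in>chain_module V c (Suc (Suc 0)). v = boundary c K (Suc 0) w)"
proof
  have v: "v \<in> chain_module V s (Suc 0)" using v by (simp add: c_simps)
  have s0: "s 0 = [0]" "t 0 = [0]" using F G by (auto simp: aug_resolution_def)
  assume "\<forall>a. boundary c K 0 v a \<in> I''"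
  then obtain g r where g: "boundary s D 0 v 0 = g + f * r" "g \<in> I" "r \<in> polys V"
    unfolding boundary_0 I'' by blast
  \<comment> \<open>The scalar \<open>r\<close> as a vector of the rank one module in position
    0.\<close>
  define y :: "nat \<Rightarrow> 'a mpoly" where "y = (\<lambda>a. if a = 0 then r else 0)"
  have "y \<in> chain_module V t 0" using g(3) by (auto simp: free_module_def y_def s0)
  then obtain z where z: "z \<in> chain_module V t 1" "\<And>a. boundary t E 0 z a - y a \<in> I'"
    using G unfolding aug_resolution_def by blast
  have z1: "z \<in> chain_module V t (Suc 0)" using z by simp
  define u where "u = (\<lambda>a. v a - \<Phi> (Suc 0) z a)"
  have u: "u \<in> chain_module V s (Suc 0)"
    unfolding u_def by (intro free_module_diff v graded_map_free[OF \<phi>_graded z1])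
  have "boundary s D 0 u a \<in> I" for a
  proof (cases "a = 0")
    case True
    have 1: "boundary s D 0 (\<Phi> (Suc 0) z) 0 - f * boundary t E 0 z 0 \<in> I"
      using \<phi>_comm[OF z1, of 0] by (simp add: target_ideal_def \<phi>0 s0 mat_apply_def[of _ _ "\<lambda>_ _. f"])
    have "boundary t E 0 z 0 - r \<in> I'" using z(2)[of 0] by (simp add: y_def)
    hence 2: "f * (boundary t E 0 z 0 - r) \<in> I" using colon hideal_polys[OF I'] by blast
    have "boundary s D 0 u 0 = g - (boundary s D 0 (\<Phi> (Suc 0) z) 0 - f * boundary t E 0 z 0)
        - f * (boundary t E 0 z 0 - r)"
      unfolding u_def linear_sub[OF linear_mat_apply] using g(1) by (simp add: algebra_simps)
    also have "\<dots> \<in> I" by (intro hideal_diff[OF I] g 1 2)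
    finally show ?thesis using True by simp
  next
    case False
    thus ?thesis by (simp add: s0 mat_apply_outside hideal_zero[OF I])
  qed
  then obtain w where w: "w \<in> chain_module V s (Suc (Suc 0))" "u = boundary s D (Suc 0) w"
    using aug_resolution_exact[OF F u] by (auto simp: target_ideal_def)
  have "v = boundary c K (Suc 0) (join_vec (length (s (Suc (Suc 0)))) w z)"
    unfolding boundary_join[OF w(1)] w(2)[symmetric]
    using free_moduleD(2)[OF v] by (auto simp: fun_eq_iff u_def join_vec_def)
  thus "\<exists>w\<in>chain_module V c (Suc (Suc 0)). v = boundary c K (Suc 0) w"
    using join_free[OF w(1) z1] by blast
next
  have s0: "s 0 = [0]" "t 0 = [0]" using F G by (auto simp: aug_resolution_def)
  assume "\<exists>w\<in>chain_module V c (Suc (Suc 0)). v = boundary c K (Suc 0) w"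
  then obtain w where w: "w \<in> chain_module V c (Suc (Suc 0))" "v = boundary c K (Suc 0) w" by blast
  define x where "x = (\<lambda>a. if a < length (s (Suc (Suc 0))) then w a else 0)"
  define z where "z = (\<lambda>b. w (length (s (Suc (Suc 0))) + b))"
  have xz: "x \<in> chain_module V s (Suc (Suc 0))" "z \<in> chain_module V t (Suc 0)"
    using w(1) by (auto simp: free_module_def x_def z_def c_simps)
  have "w = join_vec (length (s (Suc (Suc 0)))) x z"
    by (auto simp: x_def z_def join_vec_def fun_eq_iff)
  hence "v = join_vec (length (s (Suc 0))) (\<lambda>a. boundary s D (Suc 0) x a + \<Phi> (Suc 0) z a) (\<lambda>_. 0)"
    using w(2) boundary_join[OF xz(1)] by simp
  also have "\<dots> = (\<lambda>a. boundary s D (Suc 0) x a + \<Phi> (Suc 0) z a)"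
    by (auto simp: join_vec_def fun_eq_iff mat_apply_outside)
  finally have v: "v = (\<lambda>a. boundary s D (Suc 0) x a + \<Phi> (Suc 0) z a)" .
  show "\<forall>a. boundary c K 0 v a \<in> I''"
  proof
    fix a
    show "boundary c K 0 v a \<in> I''"
    proof (cases "a = 0")
      case True
      have 1: "boundary s D 0 (\<Phi> (Suc 0) z) 0 - f * boundary t E 0 z 0 \<in> I"
        using \<phi>_comm[OF xz(2), of 0] by (simp add: target_ideal_def \<phi>0 s0 mat_apply_def[of _ _ "\<lambda>_ _. f"])
      have "boundary s D 0 (boundary s D (Suc 0) x) 0 \<in> I"
        using boundary_boundary[OF xz(1), of 0] by (simp add: target_ideal_def)
      hence "boundary s D 0 (boundary s D (Suc 0) x) 0 + (boundary s D 0 (\<Phi> (Suc 0) z) 0 - f * boundary t E 0 z 0) \<in> I"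
        by (rule hideal_add[OF I _ 1])
      moreover have "boundary t E 0 z 0 \<in> polys V" by (rule free_moduleD(1)[OF boundary_free[OF G xz(2)]])
      moreover have "boundary c K 0 v 0 = (boundary s D 0 (boundary s D (Suc 0) x) 0 +
          (boundary s D 0 (\<Phi> (Suc 0) z) 0 - f * boundary t E 0 z 0)) + f * boundary t E 0 z 0"
        unfolding boundary_0 v linear_add[OF linear_mat_apply] by simp
      ultimately show ?thesis using True unfolding I'' by blast
    next
      case False
      have "boundary c K 0 v a = 0" using False unfolding boundary_0 by (simp add: s0 mat_apply_outside)
      thus ?thesis unfolding I'' using hideal_zero[OF I] by (intro CollectI exI[of _ 0]) simp
    qed
  qed
qed

text \<open>For a cycle \<open>(x, y)\<close> of the cone, \<open>y\<close> is a cycle of the second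
  complex and hence a boundary; subtracting the cone boundary of a preimage leaves a cycle in the
  first complex.\<close>

lemma exact_Suc:
  assumes v: "v \<in> chain_module V c (Suc (Suc j))"
  shows "boundary c K (Suc j) v = (\<lambda>_. 0) \<longleftrightarrow>
    (\<exists>w\<in>chain_module V c (Suc (Suc (Suc j))). v = boundary c K (Suc (Suc j)) w)"
proof
  have s0: "s 0 = [0]" "t 0 = [0]" using F G by (auto simp: aug_resolution_def)
  define x where "x = (\<lambda>a. if a < length (s (Suc (Suc j))) then v a else 0)"
  define y where "y = (\<lambda>b. v (length (s (Suc (Suc j))) + b))"
  have xy: "x \<in> chain_module V s (Suc (Suc j))" "y \<in> chain_module V t (Suc j)"
    using v by (auto simp: free_module_def x_def y_def c_simps)
  have v_join: "v = join_vec (length (s (Suc (Suc j)))) x y"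
    by (auto simp: x_def y_def join_vec_def fun_eq_iff)
  assume "boundary c K (Suc j) v = (\<lambda>_. 0)"
  hence bv: "join_vec (length (s (Suc j))) (\<lambda>a. boundary s D (Suc j) x a + \<Phi> (Suc j) y a)
      (\<lambda>a. if j = 0 then 0 else - boundary t E j y a) = (\<lambda>_. 0)"
    by (simp only: v_join boundary_join[OF xy(1)])
  have top: "boundary s D (Suc j) x a + \<Phi> (Suc j) y a = 0" for a
    using fun_cong[OF bv, of a] by (cases "a < length (s (Suc j))") (auto simp: join_vec_def mat_apply_outside)
  have bot: "boundary t E j y a = 0" if "j \<noteq> 0" for a
    using fun_cong[OF bv, of "length (s (Suc j)) + a"] that by (auto simp: join_vec_def)
  have \<Phi>y: "\<Phi> (Suc j) y = (\<lambda>a. - boundary s D (Suc j) x a)"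
    using top by (auto simp: fun_eq_iff add_eq_0_iff)
  \<comment> \<open>For \<open>j = 0\<close> the second row of the cone gives no information on
    \<open>y\<close>. Instead \<open>f\<close> times its augmentation lies in \<open>I\<close>, so
    the augmentation lies in the colon ideal \<open>I'\<close>.\<close>
  have "boundary t E j y a \<in> target_ideal I' j" for a
  proof (cases "j = 0")
    case False
    thus ?thesis by (simp add: bot target_ideal_def)
  next
    case j: True
    show ?thesis
    proof (cases "a = 0")
      case True
      have y1: "y \<in> chain_module V t (Suc 0)" using xy(2) j by simp
      have 1: "boundary s D 0 (\<Phi> (Suc 0) y) 0 - f * boundary t E 0 y 0 \<in> I"
        using \<phi>_comm[OF y1, of 0] by (simp add: target_ideal_def \<phi>0 s0 mat_apply_def[of _ _ "\<lambda>_ _. f"])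
      have "boundary s D 0 (\<Phi> (Suc 0) y) 0 = - boundary s D 0 (boundary s D (Suc 0) x) 0"
        using \<Phi>y by (simp add: j linear_uminus[OF linear_mat_apply])
      also have "\<dots> \<in> I"
        using boundary_boundary[OF xy(1), of 0] by (simp add: j target_ideal_def hideal_uminus[OF I])
      finally have "f * boundary t E 0 y 0 \<in> I" using hideal_cong[OF I 1] by blast
      thus ?thesis
        using True j colon free_moduleD(1)[OF boundary_free[OF G y1]] by (simp add: target_ideal_def)
    next
      case False
      thus ?thesis using j by (simp add: s0 mat_apply_outside hideal_zero[OF homogeneous_target[OF I']])
    qed
  qed
  then obtain z' where z': "z' \<in> chain_module V t (Suc (Suc j))" "y = boundary t E (Suc j) z'"
    using aug_resolution_exact[OF G xy(2)] by blast
  \<comment> \<open>The negation compensates the sign of \<open>E\<close> in the cone.\<close>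
  define z where "z = (\<lambda>a. - z' a)"
  have z: "z \<in> chain_module V t (Suc (Suc j))" unfolding z_def by (rule free_module_uminus[OF z'(1)])
  have yz: "y = (\<lambda>a. - boundary t E (Suc j) z a)"
    by (simp add: z_def z'(2) linear_uminus[OF linear_mat_apply])
  define u where "u = (\<lambda>a. x a - \<Phi> (Suc (Suc j)) z a)"
  have u: "u \<in> chain_module V s (Suc (Suc j))"
    unfolding u_def by (intro free_module_diff xy(1) graded_map_free[OF \<phi>_graded z])
  have "boundary s D (Suc j) u a = 0" for a
  proof -
    have "boundary s D (Suc j) (\<Phi> (Suc (Suc j)) z) a = \<Phi> (Suc j) (boundary t E (Suc j) z) a"
      using \<phi>_comm[OF z, of a] by (simp add: target_ideal_def)
    also have "\<dots> = - \<Phi> (Suc j) y a" unfolding yz linear_uminus[OF linear_mat_apply] by simp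
    also have "\<dots> = boundary s D (Suc j) x a" by (simp add: \<Phi>y)
    finally show ?thesis unfolding u_def linear_sub[OF linear_mat_apply] by simp
  qed
  then obtain w where w: "w \<in> chain_module V s (Suc (Suc (Suc j)))" "u = boundary s D (Suc (Suc j)) w"
    using aug_resolution_exact[OF F u] by (auto simp: target_ideal_def)
  have "v = boundary c K (Suc (Suc j)) (join_vec (length (s (Suc (Suc (Suc j))))) w z)"
    unfolding boundary_join[OF w(1)] v_join yz w(2)[symmetric] by (simp add: u_def)
  thus "\<exists>w\<in>chain_module V c (Suc (Suc (Suc j))). v = boundary c K (Suc (Suc j)) w"
    using join_free[OF w(1) z] by blast
next
  assume "\<exists>w\<in>chain_module V c (Suc (Suc (Suc j))). v = boundary c K (Suc (Suc j)) w"
  then obtain w' where w': "w' \<in> chain_module V c (Suc (Suc (Suc j)))" "v = boundary c K (Suc (Suc j)) w'" by blast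
  define w where "w = (\<lambda>a. if a < length (s (Suc (Suc (Suc j)))) then w' a else 0)"
  define z where "z = (\<lambda>b. w' (length (s (Suc (Suc (Suc j)))) + b))"
  have wz: "w \<in> chain_module V s (Suc (Suc (Suc j)))" "z \<in> chain_module V t (Suc (Suc j))"
    using w'(1) by (auto simp: free_module_def w_def z_def c_simps)
  have w'_join: "w' = join_vec (length (s (Suc (Suc (Suc j))))) w z"
    by (auto simp: w_def z_def join_vec_def fun_eq_iff)
  define x where "x = (\<lambda>a. boundary s D (Suc (Suc j)) w a + \<Phi> (Suc (Suc j)) z a)"
  define y where "y = (\<lambda>a. - boundary t E (Suc j) z a)"
  have x: "x \<in> chain_module V s (Suc (Suc j))"
    unfolding x_def by (intro free_module_add boundary_free[OF F wz(1)] graded_map_free[OF \<phi>_graded wz(2)])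
  have v_join: "v = join_vec (length (s (Suc (Suc j)))) x y"
    unfolding w'(2) w'_join boundary_join[OF wz(1)] x_def y_def by simp
  have "boundary s D (Suc j) x a + \<Phi> (Suc j) y a = 0" for a
  proof -
    have "boundary s D (Suc j) (\<Phi> (Suc (Suc j)) z) a = \<Phi> (Suc j) (boundary t E (Suc j) z) a"
      using \<phi>_comm[OF wz(2), of a] by (simp add: target_ideal_def)
    moreover have "boundary s D (Suc j) (boundary s D (Suc (Suc j)) w) a = 0"
      using boundary_boundary[OF wz(1), of a] by (simp add: target_ideal_def)
    ultimately show ?thesis
      unfolding x_def y_def linear_add[OF linear_mat_apply] linear_uminus[OF linear_mat_apply] by simp
  qed
  moreover have "boundary t E j y a = 0" if "j \<noteq> 0" for a
  proof -
    have "boundary t E j (boundary t E (Suc j) z) a \<in> target_ideal I' j"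
      using aug_resolution_exact[OF G boundary_free[OF G wz(2)]] wz(2) by blast
    thus ?thesis using that unfolding y_def linear_uminus[OF linear_mat_apply] by (simp add: target_ideal_def)
  qed
  ultimately show "boundary c K (Suc j) v = (\<lambda>_. 0)"
    unfolding v_join boundary_join[OF x] by (auto simp: join_vec_def fun_eq_iff)
qed

lemma cone_resolution: "aug_resolution V I'' c K"
  unfolding aug_resolution_def
proof (intro conjI allI ballI)
  show "c 0 = [0]" using F by (simp add: aug_resolution_def c_simps)
  show "graded_map V 0 (c (Suc i)) (c i) (K i)" for i by (rule graded_cone)
next
  fix y :: "nat \<Rightarrow> 'a mpoly" assume "y \<in> chain_module V c 0"
  then obtain w where w: "w \<in> chain_module V s 1" "\<forall>a. boundary s D 0 w a - y a \<in> I"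
    using F unfolding aug_resolution_def c_simps by blast
  have "g \<in> I''" if "g \<in> I" for g
    unfolding I'' using that by (intro CollectI exI[of _ g] exI[of _ 0]) simp
  thus "\<exists>w\<in>chain_module V c 1. \<forall>a. boundary c K 0 w a - y a \<in> I''"
    unfolding boundary_0 using w by (auto simp: c_simps)
next
  fix i and v :: "nat \<Rightarrow> 'a mpoly" assume v: "v \<in> chain_module V c (Suc i)"
  show "(\<forall>a. boundary c K i v a \<in> target_ideal I'' i) \<longleftrightarrow>
        (\<exists>w\<in>chain_module V c (Suc (Suc i)). v = boundary c K (Suc i) w)"
  proof (cases i)
    case 0
    thus ?thesis using exact_0[of v] v by (simp add: target_ideal_def)
  next
    case (Suc j)
    have "(\<forall>a. boundary c K i v a \<in> target_ideal I'' i) \<longleftrightarrow> boundary c K (Suc j) v = (\<lambda>_. 0)"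
      by (auto simp: Suc target_ideal_def fun_eq_iff)
    thus ?thesis using exact_Suc[of v j] v Suc by simp
  qed
qed

lemma cone_minimal:
  assumes min: "minimal_complex s D" "minimal_complex t E"
    and deg: "\<And>i x y. x \<in> set (s (Suc i)) \<Longrightarrow> y \<in> set (t (Suc i)) \<Longrightarrow> x \<noteq> y + d"
  shows "minimal_complex c K"
  unfolding minimal_complex_def
proof (intro allI impI)
  fix i a b assume ab: "a < length (c (Suc i))" "b < length (c (Suc (Suc i)))"
  let ?p = "length (s (Suc i))" and ?q = "length (s (Suc (Suc i)))"
  have c2: "c (Suc (Suc i)) = s (Suc (Suc i)) @ map (\<lambda>x. x + d) (t (Suc i))"
    by (rule c_simps)
  have c1: "c (Suc i) = s (Suc i) @ (if i = 0 then [] else map (\<lambda>x. x + d) (t i))"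
    by (simp add: cone_shifts_def)
  consider "a < ?p" "b < ?q" | "a < ?p" "b \<ge> ?q" | "a \<ge> ?p" "b < ?q" | "a \<ge> ?p" "b \<ge> ?q" by linarith
  thus "Poly_Mapping.lookup (K (Suc i) a b) 0 = 0"
  proof cases
    case 1
    hence "K (Suc i) a b = D (Suc i) a b" by (simp add: cone_diff_def block_mat_def)
    thus ?thesis using min(1) 1 by (simp add: minimal_complex_def)
  next
    case 2
    have b: "b - ?q < length (t (Suc i))" using ab 2 by (simp add: c2)
    have K: "K (Suc i) a b = \<phi> (Suc i) a (b - ?q)" using 2 by (simp add: cone_diff_def block_mat_def)
    show ?thesis
    proof (rule ccontr)
      assume "\<not> ?thesis"
      hence "0 \<in> Poly_Mapping.keys (\<phi> (Suc i) a (b - ?q))" by (simp add: K in_keys_iff)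
      hence "mon_degree 0 + s (Suc i) ! a = t (Suc i) ! (b - ?q) + d"
        using \<phi>_graded[of "Suc i"] 2(1) b unfolding graded_map_def by blast
      thus False using deg[of "s (Suc i) ! a" i "t (Suc i) ! (b - ?q)"] 2(1) b by simp
    qed
  next
    case 3
    thus ?thesis by (simp add: cone_diff_def block_mat_def)
  next
    case 4
    have b: "b - ?q < length (t (Suc i))" using ab 4 by (simp add: c2)
    \<comment> \<open>Position 1 of the cone has no part from the second complex. So the block of
      \<open>E\<close> occurs only for \<open>i > 0\<close>, where minimality of that complex
      applies.\<close>
    obtain j where j: "i = Suc j" using ab 4 by (cases i) (auto simp: c_simps)
    have a: "a - ?p < length (t i)" using ab(1) 4(1) unfolding c1 by (simp add: j)
    have "K (Suc i) a b = - E i (a - ?p) (b - ?q)" using 4 by (simp add: cone_diff_def block_mat_def)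
    moreover have "Poly_Mapping.lookup (E i (a - ?p) (b - ?q)) 0 = 0"
      using min(2) a b unfolding minimal_complex_def j by blast
    ultimately show ?thesis by simp
  qed
qed

end

lemma mapping_cone_resolution:
  assumes res: "aug_resolution V I s D" "minimal_complex s D" and I: "homogeneous_ideal V I"
    and res': "aug_resolution V I' t E" "minimal_complex t E" and I': "homogeneous_ideal V I'"
    and f: "f \<in> polys V" "\<And>m. m \<in> Poly_Mapping.keys f \<Longrightarrow> mon_degree m = d"
    and colon: "\<And>r. r \<in> polys V \<Longrightarrow> r \<in> I' \<longleftrightarrow> f * r \<in> I"
    and deg: "\<And>i x y. x \<in> set (s (Suc i)) \<Longrightarrow> y \<in> set (t (Suc i)) \<Longrightarrow> x \<noteq> y + d"
  shows "\<exists>K. aug_resolution V {g + f * r | g r. g \<in> I \<and> r \<in> polys V} (cone_shifts d s t) K \<and>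
             minimal_complex (cone_shifts d s t) K"
proof -
  have f_colon: "f * r \<in> I" if "r \<in> I'" for r
    using colon[OF hideal_polys[OF I' that]] that by simp
  obtain \<phi> where "\<phi> 0 = (\<lambda>_ _. f)" "\<And>i. graded_map V d (t i) (s i) (\<phi> i)"
    "\<And>i v a. v \<in> chain_module V t (Suc i) \<Longrightarrow>
        boundary s D i (mat_apply (length (s (Suc i))) (length (t (Suc i))) (\<phi> (Suc i)) v) a
        - mat_apply (length (s i)) (length (t i)) (\<phi> i) (boundary t E i v) a \<in> target_ideal I i"
    using chain_map_exists[OF res(1) I res'(1) I' f f_colon] by blast
  then interpret mapping_cone V I I' "{g + f * r | g r. g \<in> I \<and> r \<in> polys V}" s t D E \<phi> f d
    using res(1) I res'(1) I' f colon by unfold_locales (auto simp only:)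
  show ?thesis 
    by (intro exI[of _ "cone_diff s D E \<phi>"] conjI cone_resolution cone_minimal[OF res(2) res'(2)] deg)
qed

section \<open>Resolutions of monomial ideals with linear quotients\<close>

lemma lookup_monomial_mult:
  fixes r :: "'a::field mpoly"
  shows "Poly_Mapping.lookup (Poly_Mapping.single g 1 * r) (g + m) = Poly_Mapping.lookup r m"
proof -
  let ?g = "Poly_Mapping.single g (1 :: 'a)" and ?m = "Poly_Mapping.single m (Poly_Mapping.lookup r m)"
  let ?r = "restr (\<lambda>k. k \<noteq> m) r"
  have r: "r = ?m + ?r"
    by (rule poly_mapping_eqI) (auto simp: lookup_add lookup_single when_def lookup_restr)
  have "g + m \<notin> Poly_Mapping.keys (?g * ?r)"
    by (auto elim!: keys_mult_subset simp: keys_restr split: if_splits)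
  hence "Poly_Mapping.lookup (?g * ?r) (g + m) = 0" by (simp add: in_keys_iff)
  moreover have "?g * r = Poly_Mapping.single (g + m) (Poly_Mapping.lookup r m) + ?g * ?r"
    by (subst (1) r) (simp add: distrib_left mult_single)
  ultimately show ?thesis by (simp add: lookup_add)
qed

lemma monomial_ideal_colon:
  assumes "r \<in> polys V" and "Poly_Mapping.keys g \<subseteq> V"
  shows "r \<in> monomial_ideal V {m. g + m \<in> U} \<longleftrightarrow> Poly_Mapping.single g 1 * r \<in> monomial_ideal V U"
proof
  have "Poly_Mapping.single g 1 \<in> polys V" using assms(2) by (simp add: polys_def)
  hence p: "Poly_Mapping.single g 1 * r \<in> polys V" using assms(1) by blast
  assume "r \<in> monomial_ideal V {m. g + m \<in> U}"
  thus "Poly_Mapping.single g 1 * r \<in> monomial_ideal V U"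
    using p by (auto simp: monomial_ideal_def elim!: keys_mult_subset split: if_splits)
next
  assume a: "Poly_Mapping.single g 1 * r \<in> monomial_ideal V U"
  have "g + m \<in> U" if "m \<in> Poly_Mapping.keys r" for m
  proof -
    have "g + m \<in> Poly_Mapping.keys (Poly_Mapping.single g 1 * r)"
      using that by (simp add: in_keys_iff lookup_monomial_mult)
    thus ?thesis using a by (auto simp: monomial_ideal_def)
  qed
  thus "r \<in> monomial_ideal V {m. g + m \<in> U}" using assms(1) by (auto simp: monomial_ideal_def)
qed

lemma monomial_divide:
  fixes h :: "'a::field mpoly"
  assumes "h \<in> polys V" "\<And>k. k \<in> Poly_Mapping.keys h \<Longrightarrow> \<exists>m. k = g + m"
  obtains r where "r \<in> polys V" "h = Poly_Mapping.single g 1 * r"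
proof
  \<comment> \<open>Pulling coefficients back along the injective shift by \<open>g\<close> is
    division by the monomial.\<close>
  let ?r = "Poly_Mapping.map_key (\<lambda>m. g + m) h"
  have inj: "inj (\<lambda>m. g + m)" by (auto simp: inj_def)
  have l: "Poly_Mapping.lookup ?r m = Poly_Mapping.lookup h (g + m)" for m
    using map_key.rep_eq[OF inj, of h] by simp
  show "?r \<in> polys V"
    unfolding polys_def
  proof (intro CollectI ballI)
    fix m assume "m \<in> Poly_Mapping.keys ?r"
    hence "g + m \<in> Poly_Mapping.keys h" by (simp add: in_keys_iff l)
    thus "Poly_Mapping.keys m \<subseteq> V" using assms(1) by (force simp: polys_def keys_add_nat)
  qed
  show "h = Poly_Mapping.single g 1 * ?r"
  proof (rule poly_mapping_eqI)
    fix k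
    show "Poly_Mapping.lookup h k = Poly_Mapping.lookup (Poly_Mapping.single g 1 * ?r) k"
    proof (cases "\<exists>m. k = g + m")
      case True
      thus ?thesis by (auto simp: lookup_monomial_mult l)
    next
      case False
      hence "k \<notin> Poly_Mapping.keys h" "k \<notin> Poly_Mapping.keys (Poly_Mapping.single g 1 * ?r)"
        using assms(2) by (auto elim!: keys_mult_subset split: if_splits)
      thus ?thesis by (simp add: in_keys_iff)
    qed
  qed
qed

lemma monomial_ideal_plus_principal:
  fixes U g V
  assumes U: "up_closed U" and g: "Poly_Mapping.keys g \<subseteq> V"
  shows "{h + Poly_Mapping.single g 1 * r | h r. h \<in> monomial_ideal V U \<and> r \<in> polys V}
       = (monomial_ideal V (U \<union> {g + m | m. True}) :: 'a::field mpoly set)"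
proof (intro equalityI subsetI)
  fix x :: "'a mpoly"
  assume "x \<in> {h + Poly_Mapping.single g 1 * r | h r. h \<in> monomial_ideal V U \<and> r \<in> polys V}"
  then obtain h r where x: "x = h + Poly_Mapping.single g 1 * r" "h \<in> monomial_ideal V U" "r \<in> polys V" by blast
  have "Poly_Mapping.single g 1 \<in> polys V" using g by (simp add: polys_def)
  hence "x \<in> polys V" unfolding x using x(2,3) by (auto simp: monomial_ideal_def)
  moreover have "Poly_Mapping.keys (Poly_Mapping.single g 1 * r) \<subseteq> {g + m | m. True}"
    by (auto elim!: keys_mult_subset split: if_splits)
  ultimately show "x \<in> monomial_ideal V (U \<union> {g + m | m. True})"
    using keys_add[of h "Poly_Mapping.single g 1 * r"] x(2) unfolding monomial_ideal_def x(1) by blast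
next
  fix x :: "'a mpoly" assume x: "x \<in> monomial_ideal V (U \<union> {g + m | m. True})"
  \<comment> \<open>The terms of \<open>x\<close> outside \<open>U\<close> are all divisible by
    \<open>g\<close>; the others already form an element of the first ideal.\<close>
  let ?y = "restr (\<lambda>m. m \<notin> U) x"
  have "?y \<in> polys V" "\<And>k. k \<in> Poly_Mapping.keys ?y \<Longrightarrow> \<exists>m. k = g + m"
    using x by (auto simp: monomial_ideal_def keys_restr)
  then obtain r where r: "r \<in> polys V" "?y = Poly_Mapping.single g 1 * r" by (rule monomial_divide)
  have "restr (\<lambda>m. m \<in> U) x \<in> monomial_ideal V U"
    using x by (auto simp: monomial_ideal_def keys_restr)
  moreover have "x = restr (\<lambda>m. m \<in> U) x + Poly_Mapping.single g 1 * r"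
    using restr_split[of x "\<lambda>m. m \<in> U"] r(2) by simp
  ultimately show "x \<in> {h + Poly_Mapping.single g 1 * r | h r. h \<in> monomial_ideal V U \<and> r \<in> polys V}"
    using r(1) by blast
qed

text \<open>The differentials are hidden: the cone construction only has to track shifts, which
  determine the Betti numbers.\<close>

definition has_shifts :: "'a::field itself \<Rightarrow> nat set \<Rightarrow> (nat \<Rightarrow>\<^sub>0 nat) set \<Rightarrow> (nat \<Rightarrow> nat list) \<Rightarrow> bool" where
  "has_shifts K V U s \<longleftrightarrow> up_closed U \<and>
     (\<exists>D. aug_resolution V (monomial_ideal V U :: 'a mpoly set) s D \<and> minimal_complex s D)"

lemma has_shifts_cone:
  assumes U: "has_shifts TYPE('a::field) V U s" and U': "has_shifts TYPE('a) V {m. g + m \<in> U} t"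
    and g: "Poly_Mapping.keys g \<subseteq> V"
    and deg: "\<And>i x y. x \<in> set (s (Suc i)) \<Longrightarrow> y \<in> set (t (Suc i)) \<Longrightarrow> x \<noteq> y + mon_degree g"
  shows "has_shifts TYPE('a) V (U \<union> {g + m | m. True}) (cone_shifts (mon_degree g) s t)"
proof -
  from U obtain D where D: "up_closed U" "aug_resolution V (monomial_ideal V U :: 'a mpoly set) s D" "minimal_complex s D"
    by (auto simp: has_shifts_def)
  from U' obtain E where E: "up_closed {m. g + m \<in> U}"
      "aug_resolution V (monomial_ideal V {m. g + m \<in> U} :: 'a mpoly set) t E" "minimal_complex t E"
    by (auto simp: has_shifts_def)
  have "\<exists>K. aug_resolution V {h + Poly_Mapping.single g 1 * r | h r. h \<in> monomial_ideal V U \<and> r \<in> polys V}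
        (cone_shifts (mon_degree g) s t) (K :: _ \<Rightarrow> _ \<Rightarrow> _ \<Rightarrow> 'a mpoly) \<and> minimal_complex (cone_shifts (mon_degree g) s t) K"
    by (rule mapping_cone_resolution[OF D(2,3) homogeneous_ideal_monomial[OF D(1)] E(2,3)
          homogeneous_ideal_monomial[OF E(1)] _ _ monomial_ideal_colon[OF _ g] deg])
       (use g in \<open>auto simp: polys_def split: if_splits\<close>)
  moreover have "up_closed (U \<union> {g + m | m. True})"
    using D(1) by (auto simp: up_closed_def add.assoc)
  ultimately show ?thesis
    unfolding has_shifts_def monomial_ideal_plus_principal[OF D(1) g] by blast
qed

section \<open>Koszul complexes\<close>

definition meets :: "nat set \<Rightarrow> (nat \<Rightarrow>\<^sub>0 nat) set" where
  "meets A = {m. Poly_Mapping.keys m \<inter> A \<noteq> {}}"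

text \<open>Shifts of the Koszul complex on \<open>a\<close> variables, with the augmenting ring in
  front. It resolves the quotient by the ideal of the variables in a set \<open>A\<close> of size
  \<open>a\<close>, whose exponents are \<open>meets A\<close>.\<close>

definition koszul_shifts :: "nat \<Rightarrow> nat \<Rightarrow> nat list" where
  "koszul_shifts a i = (case i of 0 \<Rightarrow> [0] | Suc j \<Rightarrow> replicate (a choose j) j)"

lemma replicate_append: "replicate p x @ replicate q x = replicate (q + p) x"
  by (simp add: replicate_add[symmetric] add.commute)

text \<open>Pascal's rule, once per position.\<close>

lemma cone_koszul: "cone_shifts 1 (koszul_shifts a) (koszul_shifts a) = koszul_shifts (Suc a)"
proof
  fix i
  show "cone_shifts 1 (koszul_shifts a) (koszul_shifts a) i = koszul_shifts (Suc a) i"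
  proof (cases i)
    case 0
    thus ?thesis by (simp add: cone_shifts_def koszul_shifts_def)
  next
    case (Suc j)
    thus ?thesis
      by (cases j) (simp_all add: cone_shifts_def koszul_shifts_def replicate_append)
  qed
qed

lemma mon_split:
  assumes "v \<in> Poly_Mapping.keys (m :: nat \<Rightarrow>\<^sub>0 nat)"
  shows "m = Poly_Mapping.single v 1 + (m - Poly_Mapping.single v 1)"
  using assms by (intro poly_mapping_eqI) (auto simp: lookup_add lookup_minus lookup_single when_def in_keys_iff)

lemma has_shifts_koszul_empty: "has_shifts TYPE('a::field) V {} (koszul_shifts 0)"
proof -
  \<comment> \<open>The complex is the identity of \<open>R\<close> followed by zero modules, so
    only the single entry of \<open>D 0\<close> lies inside a matrix.\<close>
  define D where "D = (\<lambda>(i::nat) (a::nat) (b::nat). 1 :: 'a mpoly)"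
  have I: "monomial_ideal V {} = ({0} :: 'a mpoly set)"
    by (auto simp: monomial_ideal_def)
  have k: "koszul_shifts 0 0 = [0]" "koszul_shifts 0 (Suc 0) = [0]" "koszul_shifts 0 (Suc (Suc i)) = []" for i
    by (simp_all add: koszul_shifts_def)
  have free0: "v \<in> free_module V 0 \<longleftrightarrow> v = (\<lambda>_. 0)" for v :: "nat \<Rightarrow> 'a mpoly"
    by (auto simp: free_module_def)
  have D0: "mat_apply (Suc 0) (Suc 0) (D 0) v = v" if "v \<in> free_module V (Suc 0)" for v
    using free_moduleD(2)[OF that] by (auto simp: mat_apply_def D_def fun_eq_iff)
  have "aug_resolution V {0} (koszul_shifts 0) D"
    unfolding aug_resolution_def
  proof (intro conjI allI ballI)
    show "graded_map V 0 (koszul_shifts 0 (Suc i)) (koszul_shifts 0 i) (D i)" for i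
      by (cases i) (auto simp: graded_map_def k D_def)
    show "\<exists>w\<in>chain_module V (koszul_shifts 0) 1. \<forall>a. boundary (koszul_shifts 0) D 0 w a - y a \<in> {0}"
      if "y \<in> chain_module V (koszul_shifts 0) 0" for y
      using that D0[of y] by (intro bexI[of _ y]) (auto simp: k)
    show "(\<forall>a. boundary (koszul_shifts 0) D i v a \<in> target_ideal {0} i) \<longleftrightarrow>
        (\<exists>w\<in>chain_module V (koszul_shifts 0) (Suc (Suc i)). v = boundary (koszul_shifts 0) D (Suc i) w)"
      if v: "v \<in> chain_module V (koszul_shifts 0) (Suc i)" for i v
    proof (cases i)
      case 0
      have "(\<exists>w\<in>free_module V 0. P w) \<longleftrightarrow> P (\<lambda>_. 0)" for P :: "(nat \<Rightarrow> 'a mpoly) \<Rightarrow> bool"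
        by (auto simp: free0)
      thus ?thesis using v D0[of v] 0
        by (simp add: k target_ideal_def linear_zero[OF linear_mat_apply]) (simp add: fun_eq_iff)
    next
      case (Suc j)
      thus ?thesis using v
        by (simp add: k free0 target_ideal_def linear_zero[OF linear_mat_apply])
    qed
  qed (simp add: k)
  moreover have "minimal_complex (koszul_shifts 0) D" by (simp add: minimal_complex_def k)
  ultimately show ?thesis unfolding has_shifts_def I by (auto simp: up_closed_def)
qed

text \<open>A variable \<open>x\<close> outside \<open>A\<close> is a nonzerodivisor modulo the
  variables in \<open>A\<close>, so the colon ideal by \<open>x\<close> is the old ideal and the
  cone joins two copies of the same complex, one of them shifted by 1.\<close>

lemma has_shifts_koszul:
  assumes "finite A" "A \<subseteq> V"
  shows "has_shifts TYPE('a::field) V (meets A) (koszul_shifts (card A))"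
  using assms
proof (induction A rule: finite_induct)
  case empty
  have "meets {} = {}" by (simp add: meets_def)
  thus ?case by (simp add: has_shifts_koszul_empty)
next
  case (insert x A)
  let ?g = "Poly_Mapping.single x (1 :: nat)"
  have IH: "has_shifts TYPE('a) V (meets A) (koszul_shifts (card A))" using insert by simp
  have colon: "{m. ?g + m \<in> meets A} = meets A"
    using insert.hyps(2) by (auto simp: meets_def keys_add_nat)
  have "has_shifts TYPE('a) V (meets A \<union> {?g + m | m. True})
      (cone_shifts (mon_degree ?g) (koszul_shifts (card A)) (koszul_shifts (card A)))"
    by (rule has_shifts_cone) (use IH colon insert.prems in \<open>auto simp: koszul_shifts_def split: if_splits\<close>)
  moreover have "meets A \<union> {?g + m | m. True} = meets (insert x A)"
  proof -
    have "m \<in> {?g + m | m. True}" if "x \<in> Poly_Mapping.keys m" for m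
      using mon_split[OF that] by blast
    thus ?thesis by (auto simp: meets_def keys_add_nat)
  qed
  ultimately show ?case using insert.hyps by (simp add: cone_koszul[unfolded One_nat_def])
qed

text \<open>\<open>c j\<close> is the Betti number in homological degree \<open>j + 1\<close>, which is position \<open>j + 2\<close>.\<close>

definition linear_shifts :: "(nat \<Rightarrow> nat) \<Rightarrow> nat \<Rightarrow> nat list" where
  "linear_shifts c i = (case i of 0 \<Rightarrow> [0] | Suc 0 \<Rightarrow> [0] | Suc (Suc j) \<Rightarrow> replicate (c j) (Suc (Suc j)))"

lemma linear_shifts_simps:
  "linear_shifts c 0 = [0]" "linear_shifts c (Suc 0) = [0]"
  "linear_shifts c (Suc (Suc j)) = replicate (c j) (Suc (Suc j))"
  by (simp_all add: linear_shifts_def)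

text \<open>Position \<open>j + 2\<close> of the cone receives Koszul position \<open>j + 1\<close>.
  Its generators of degree \<open>j\<close> move to degree \<open>j + 2\<close>, so the resolution
  stays linear.\<close>

lemma cone_linear:
  "cone_shifts 2 (linear_shifts c) (koszul_shifts a) = linear_shifts (\<lambda>j. c j + (a choose j))"
proof
  fix i
  show "cone_shifts 2 (linear_shifts c) (koszul_shifts a) i = linear_shifts (\<lambda>j. c j + (a choose j)) i"
  proof (cases i)
    case 0
    thus ?thesis by (simp add: cone_shifts_def linear_shifts_simps)
  next
    case (Suc j)
    thus ?thesis
      by (cases j) (simp_all add: cone_shifts_def linear_shifts_simps koszul_shifts_def replicate_add)
  qed
qed

text \<open>Exponents of the ideal generated by the \<open>x_a x_b\<close> that precede
  \<open>x_u x_v\<close>, the larger index being compared first.\<close>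

definition earlier_pairs :: "nat set \<Rightarrow> nat \<Rightarrow> nat \<Rightarrow> (nat \<Rightarrow>\<^sub>0 nat) set" where
  "earlier_pairs \<sigma> v u = {m. \<exists>a b. b \<in> \<sigma> \<and> a < b \<and> a \<in> Poly_Mapping.keys m \<and> b \<in> Poly_Mapping.keys m \<and>
      (b < v \<or> b = v \<and> a < u)}"

definition colon_size :: "nat set \<Rightarrow> nat \<Rightarrow> nat \<Rightarrow> nat" where
  "colon_size \<sigma> u v = u + card {b \<in> {u<..<v}. b \<in> \<sigma>}"

lemma earlier_pairsI:
  "b \<in> \<sigma> \<Longrightarrow> a < b \<Longrightarrow> a \<in> Poly_Mapping.keys m \<Longrightarrow> b \<in> Poly_Mapping.keys m \<Longrightarrow>
      b < v \<or> b = v \<and> a < u \<Longrightarrow> m \<in> earlier_pairs \<sigma> v u"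
  unfolding earlier_pairs_def by blast

text \<open>A variable \<open>x_w\<close> with \<open>w < u\<close> is in the colon ideal because of
  the earlier generator \<open>x_w x_v\<close>, and one with \<open>u < w < v\<close>,
  \<open>w \<in> \<sigma>\<close> because of \<open>x_u x_w\<close>. Conversely an earlier pair
  cannot be \<open>(u, v)\<close> itself, so one of its members comes from \<open>m\<close>, and
  this member is of one of the two kinds.\<close>

lemma earlier_pairs_colon:
  assumes "u < v" "v \<in> \<sigma>"
  shows "{m. (Poly_Mapping.single u 1 + Poly_Mapping.single v 1) + m \<in> earlier_pairs \<sigma> v u}
       = meets ({..<u} \<union> {b \<in> {u<..<v}. b \<in> \<sigma>})"
proof (intro equalityI subsetI)
  fix m assume "m \<in> {m. (Poly_Mapping.single u 1 + Poly_Mapping.single v 1) + m \<in> earlier_pairs \<sigma> v u}"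
  then obtain a b where ab: "b \<in> \<sigma>" "a < b" "a \<in> {u, v} \<union> Poly_Mapping.keys m" "b \<in> {u, v} \<union> Poly_Mapping.keys m"
      "b < v \<or> b = v \<and> a < u"
    by (auto simp: earlier_pairs_def keys_add_nat)
  have "a \<in> Poly_Mapping.keys m \<and> a < u \<or> b \<in> Poly_Mapping.keys m \<and> (b < u \<or> u < b \<and> b < v \<and> b \<in> \<sigma>)"
    using ab assms by auto
  thus "m \<in> meets ({..<u} \<union> {b \<in> {u<..<v}. b \<in> \<sigma>})" by (auto simp: meets_def)
next
  fix m assume "m \<in> meets ({..<u} \<union> {b \<in> {u<..<v}. b \<in> \<sigma>})"
  then obtain w where w: "w \<in> Poly_Mapping.keys m" "w < u \<or> u < w \<and> w < v \<and> w \<in> \<sigma>"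
    by (auto simp: meets_def)
  show "m \<in> {m. (Poly_Mapping.single u 1 + Poly_Mapping.single v 1) + m \<in> earlier_pairs \<sigma> v u}"
  proof (cases "w < u")
    case True
    thus ?thesis using w assms
      by (intro CollectI earlier_pairsI[of v _ w]) (auto simp: keys_add_nat)
  next
    case False
    thus ?thesis using w assms
      by (intro CollectI earlier_pairsI[of w _ u]) (auto simp: keys_add_nat)
  qed
qed

lemma earlier_pairs_Suc:
  assumes "u < v" "v \<in> \<sigma>"
  shows "earlier_pairs \<sigma> v (Suc u) = earlier_pairs \<sigma> v u \<union> {(Poly_Mapping.single u 1 + Poly_Mapping.single v 1) + m | m. True}"
proof -
  have "m \<in> {(Poly_Mapping.single u 1 + Poly_Mapping.single v 1) + m | m. True}"
    if m: "u \<in> Poly_Mapping.keys m" "v \<in> Poly_Mapping.keys m" for m :: "nat \<Rightarrow>\<^sub>0 nat"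
  proof -
    from mon_split[OF m(1)] obtain m' where m': "m = Poly_Mapping.single u 1 + m'" ..
    hence "v \<in> Poly_Mapping.keys m'" using m assms(1) by (simp add: keys_add_nat)
    from mon_split[OF this] obtain m'' where "m' = Poly_Mapping.single v 1 + m''" ..
    thus ?thesis using m' by (auto simp: add.assoc)
  qed
  moreover have "(Poly_Mapping.single u 1 + Poly_Mapping.single v 1) + m \<in> earlier_pairs \<sigma> v (Suc u)" for m
    using assms by (intro earlier_pairsI[of v _ u]) (auto simp: keys_add_nat)
  ultimately show ?thesis
    by (auto simp: earlier_pairs_def less_Suc_eq)
qed

lemma has_shifts_linear_step:
  assumes IH: "has_shifts TYPE('a::field) {0..n} (earlier_pairs \<sigma> v u) (linear_shifts c)"
    and uv: "u < v" "v \<in> \<sigma>" "v \<le> n"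
  shows "has_shifts TYPE('a) {0..n} (earlier_pairs \<sigma> v (Suc u)) (linear_shifts (\<lambda>j. c j + (colon_size \<sigma> u v choose j)))"
proof -
  let ?g = "Poly_Mapping.single u (1::nat) + Poly_Mapping.single v 1"
  let ?A = "{..<u} \<union> {b \<in> {u<..<v}. b \<in> \<sigma>}"
  have card: "card ?A = colon_size \<sigma> u v"
    by (subst card_Un_disjoint) (auto simp: colon_size_def)
  have "has_shifts TYPE('a) {0..n} (meets ?A) (koszul_shifts (card ?A))"
    by (rule has_shifts_koszul) (use uv in auto)
  hence kos: "has_shifts TYPE('a) {0..n} {m. ?g + m \<in> earlier_pairs \<sigma> v u} (koszul_shifts (colon_size \<sigma> u v))"
    by (simp only: earlier_pairs_colon[OF uv(1,2)] card)
  have deg: "mon_degree ?g = 2" by (simp add: mon_degree_add)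
  have "has_shifts TYPE('a) {0..n} (earlier_pairs \<sigma> v u \<union> {?g + m | m. True})
      (cone_shifts (mon_degree ?g) (linear_shifts c) (koszul_shifts (colon_size \<sigma> u v)))"
  proof (rule has_shifts_cone[OF IH kos])
    show "Poly_Mapping.keys ?g \<subseteq> {0..n}" using uv by (auto simp: keys_add_nat)
    show "x \<noteq> y + mon_degree ?g"
      if "x \<in> set (linear_shifts c (Suc i))" "y \<in> set (koszul_shifts (colon_size \<sigma> u v) (Suc i))" for i x y
      using that unfolding deg by (cases i) (auto simp: linear_shifts_simps koszul_shifts_def split: if_splits)
  qed
  thus ?thesis unfolding earlier_pairs_Suc[OF uv(1,2)] deg cone_linear .
qed

text \<open>Outer induction over the larger vertex, inner induction over the smaller one; a vertex
  outside \<open>\<sigma>\<close> adds no generator.\<close>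

lemma has_shifts_earlier_pairs:
  assumes "v \<le> Suc n"
  shows "has_shifts TYPE('a::field) {0..n} (earlier_pairs \<sigma> v 0)
     (linear_shifts (\<lambda>j. \<Sum>b | b < v \<and> b \<in> \<sigma>. \<Sum>a<b. colon_size \<sigma> a b choose j))"
  using assms
proof (induction v)
  case 0
  have "earlier_pairs \<sigma> 0 0 = {}" by (auto simp: earlier_pairs_def)
  moreover have "linear_shifts (\<lambda>_. 0) = koszul_shifts 0"
    by (auto simp: linear_shifts_def koszul_shifts_def fun_eq_iff split: nat.split)
  ultimately show ?case by (simp add: has_shifts_koszul_empty)
next
  case (Suc v)
  let ?c = "\<lambda>j. \<Sum>b | b < v \<and> b \<in> \<sigma>. \<Sum>a<b. colon_size \<sigma> a b choose j"
  have IH: "has_shifts TYPE('a) {0..n} (earlier_pairs \<sigma> v 0) (linear_shifts ?c)" using Suc by simp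
  show ?case
  proof (cases "v \<in> \<sigma>")
    case False
    have "earlier_pairs \<sigma> (Suc v) 0 = earlier_pairs \<sigma> v 0"
      using False by (auto simp: earlier_pairs_def less_Suc_eq)
    moreover have "{b. b < Suc v \<and> b \<in> \<sigma>} = {b. b < v \<and> b \<in> \<sigma>}"
      using False by (auto simp: less_Suc_eq)
    ultimately show ?thesis using IH by simp
  next
    case True
    have "has_shifts TYPE('a) {0..n} (earlier_pairs \<sigma> v u)
        (linear_shifts (\<lambda>j. ?c j + (\<Sum>a<u. colon_size \<sigma> a v choose j)))" if "u \<le> v" for u
      using that
    proof (induction u)
      case 0
      thus ?case using IH by simp
    next
      case (Suc u)
      thus ?case
        using has_shifts_linear_step[of n \<sigma> v u "\<lambda>j. ?c j + (\<Sum>a<u. colon_size \<sigma> a v choose j)"] True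
          \<open>Suc v \<le> Suc n\<close> by (simp add: add.assoc)
    qed
    from this[of v] have *: "has_shifts TYPE('a) {0..n} (earlier_pairs \<sigma> v v)
        (linear_shifts (\<lambda>j. ?c j + (\<Sum>a<v. colon_size \<sigma> a v choose j)))" by simp
    \<comment> \<open>At \<open>u = v\<close> all pairs ending in \<open>v\<close> are used up, and
      the next stage begins.\<close>
    have "earlier_pairs \<sigma> (Suc v) 0 = earlier_pairs \<sigma> v v"
      using True by (auto simp: earlier_pairs_def less_Suc_eq)
    moreover have "{b. b < Suc v \<and> b \<in> \<sigma>} = insert v {b. b < v \<and> b \<in> \<sigma>}"
      using True by auto
    ultimately show ?thesis using * by (simp add: add.commute)
  qed
qed

section \<open>Graded Betti numbers of threshold graphs\<close>

lemma poly_ring_simps [simp]: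
  "x \<oplus>\<^bsub>poly_ring V\<^esub> y = x + y" "x \<otimes>\<^bsub>poly_ring V\<^esub> y = x * y"
  "\<zero>\<^bsub>poly_ring V\<^esub> = 0" "\<one>\<^bsub>poly_ring V\<^esub> = 1"
  by (simp_all add: poly_ring_def)

lemma cring_poly_ring: "cring (poly_ring V :: 'a::field mpoly ring)"
proof (rule cringI)
  show "abelian_group (poly_ring V :: 'a mpoly ring)"
  proof (rule abelian_groupI)
    fix x :: "'a mpoly" assume "x \<in> carrier (poly_ring V)"
    thus "\<exists>y\<in>carrier (poly_ring V). y \<oplus>\<^bsub>poly_ring V\<^esub> x = \<zero>\<^bsub>poly_ring V\<^esub>"
      by (intro bexI[of _ "- x"]) auto
  qed (auto simp: algebra_simps)
  show "comm_monoid (poly_ring V :: 'a mpoly ring)"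
    by (rule comm_monoidI) (auto simp: algebra_simps)
qed (auto simp: algebra_simps)

lemma ring_poly_ring: "ring (poly_ring V :: 'a::field mpoly ring)"
  using cring_poly_ring by (rule cring.axioms(1))

lemma homogeneous_ideal_ideal:
  assumes "homogeneous_ideal V I"
  shows "ideal I (poly_ring V)"
proof (rule idealI[OF ring_poly_ring])
  interpret ring "poly_ring V :: 'a mpoly ring" by (rule ring_poly_ring)
  have inv: "\<ominus>\<^bsub>poly_ring V\<^esub> x = - x" if "x \<in> polys V" for x :: "'a mpoly"
    by (rule minus_equality) (use that in auto)
  show "subgroup I (add_monoid (poly_ring V))"
  proof
    fix x assume "x \<in> I"
    thus "inv\<^bsub>add_monoid (poly_ring V)\<^esub> x \<in> I"
      using inv[of x] hideal_polys[OF assms] hideal_uminus[OF assms] by (simp add: a_inv_def)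
  qed (use assms in \<open>auto simp: homogeneous_ideal_def\<close>)
qed (use hideal_mult[OF assms] in \<open>auto simp: mult.commute\<close>)

lemma poly_mapping_sum_singles:
  "f = (\<Sum>m\<in>Poly_Mapping.keys f. Poly_Mapping.single m (Poly_Mapping.lookup f m))"
  by (rule poly_mapping_eqI) (auto simp: lookup_sum lookup_single when_def in_keys_iff)

text \<open>Passes from the generated ideals of the definitions, both the nonedge ideal and the
  irrelevant ideal, to sets of exponents. Every term with exponent in the set is a multiple of a
  generator, and a polynomial is the sum of its terms.\<close>

lemma genideal_monomials:
  assumes G: "\<And>g. g \<in> G \<Longrightarrow> Poly_Mapping.keys g \<subseteq> V"
  shows "Idl\<^bsub>poly_ring V\<^esub> ((\<lambda>g. Poly_Mapping.single g 1) ` G)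
       = (monomial_ideal V {g + m | g m. g \<in> G} :: 'a::field mpoly set)"
proof
  interpret ring "poly_ring V :: 'a mpoly ring" by (rule ring_poly_ring)
  let ?S = "(\<lambda>g. Poly_Mapping.single g (1 :: 'a)) ` G"
  let ?U = "{g + m | g m. g \<in> G}"
  have up: "up_closed ?U" unfolding up_closed_def by (auto simp: add.assoc) blast
  have S: "?S \<subseteq> carrier (poly_ring V)" by (auto simp: polys_def dest: subsetD[OF G] split: if_splits)
  have "?S \<subseteq> monomial_ideal V ?U"
  proof
    fix x :: "'a mpoly" assume "x \<in> ?S"
    then obtain g where g: "g \<in> G" "x = Poly_Mapping.single g 1" by blast
    have "g \<in> ?U" using g(1) by (intro CollectI exI[of _ g] exI[of _ 0]) simp
    thus "x \<in> monomial_ideal V ?U" using G[OF g(1)] by (simp add: g(2) monomial_ideal_def polys_def)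
  qed
  thus "Idl\<^bsub>poly_ring V\<^esub> ?S \<subseteq> monomial_ideal V ?U"
    by (rule genideal_minimal[OF homogeneous_ideal_ideal[OF homogeneous_ideal_monomial[OF up]]])
  interpret J: ideal "Idl\<^bsub>poly_ring V\<^esub> ?S" "poly_ring V :: 'a mpoly ring"
    by (rule genideal_ideal[OF S])
  show "monomial_ideal V ?U \<subseteq> Idl\<^bsub>poly_ring V\<^esub> ?S"
  proof
    fix f :: "'a mpoly" assume f: "f \<in> monomial_ideal V ?U"
    have single: "Poly_Mapping.single k c \<in> Idl\<^bsub>poly_ring V\<^esub> ?S" if "k \<in> Poly_Mapping.keys f" for k c
    proof -
      from f that obtain g m where gm: "g \<in> G" "k = g + m" by (auto simp: monomial_ideal_def)
      have "Poly_Mapping.keys k \<subseteq> V" using f that by (auto simp: monomial_ideal_def polys_def)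
      hence "Poly_Mapping.single m c \<in> carrier (poly_ring V)"
        using gm by (auto simp: polys_def keys_add_nat)
      moreover have "Poly_Mapping.single g 1 \<in> Idl\<^bsub>poly_ring V\<^esub> ?S"
        using genideal_self[OF S] gm(1) by blast
      ultimately have "Poly_Mapping.single m c \<otimes>\<^bsub>poly_ring V\<^esub> Poly_Mapping.single g 1 \<in> Idl\<^bsub>poly_ring V\<^esub> ?S"
        by (rule J.I_l_closed[rotated])
      thus ?thesis by (simp add: mult_single gm(2) add.commute)
    qed
    have "(\<Sum>k\<in>A. Poly_Mapping.single k (Poly_Mapping.lookup f k)) \<in> Idl\<^bsub>poly_ring V\<^esub> ?S"
      if "A \<subseteq> Poly_Mapping.keys f" for A
      using finite_subset[OF that finite_keys] that
    proof (induction A rule: finite_induct)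
      case empty
      thus ?case using J.zero_closed by simp
    next
      case (insert k A)
      thus ?case using J.a_closed[OF single[of k]] by simp
    qed
    from this[of "Poly_Mapping.keys f"] show "f \<in> Idl\<^bsub>poly_ring V\<^esub> ?S"
      using poly_mapping_sum_singles[of f] by simp
  qed
qed

lemma irrelevant_ideal_iff:
  fixes f :: "'a::field mpoly"
  assumes "f \<in> polys V"
  shows "f \<in> irrelevant_ideal V \<longleftrightarrow> Poly_Mapping.lookup f 0 = 0"
proof -
  have "irrelevant_ideal V = Idl\<^bsub>poly_ring V\<^esub> ((\<lambda>g. Poly_Mapping.single g (1::'a)) ` (\<lambda>v. Poly_Mapping.single v 1) ` V)"
    by (simp add: irrelevant_ideal_def image_image var_def[abs_def])
  also have "\<dots> = monomial_ideal V {g + m | g m. g \<in> (\<lambda>v. Poly_Mapping.single v 1) ` V}"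
    by (rule genideal_monomials) auto
  finally have I: "irrelevant_ideal V = (monomial_ideal V {g + m | g m. g \<in> (\<lambda>v. Poly_Mapping.single v 1) ` V} :: 'a mpoly set)" .
  have "k \<in> {g + m | g m. g \<in> (\<lambda>v. Poly_Mapping.single v 1) ` V} \<longleftrightarrow> k \<noteq> 0"
    if "k \<in> Poly_Mapping.keys f" for k
  proof
    assume "k \<noteq> 0"
    then obtain v where v: "v \<in> Poly_Mapping.keys k" by (metis all_not_in_conv keys_eq_empty)
    have "v \<in> V" using assms that v by (auto simp: polys_def)
    thus "k \<in> {g + m | g m. g \<in> (\<lambda>v. Poly_Mapping.single v 1) ` V}" using mon_split[OF v] by blast
  next
    assume "k \<in> {g + m | g m. g \<in> (\<lambda>v. Poly_Mapping.single v 1) ` V}"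
    then obtain v m where k: "k = Poly_Mapping.single v 1 + m" by blast
    have "v \<in> Poly_Mapping.keys k" unfolding k by (simp add: keys_add_nat)
    thus "k \<noteq> 0" by auto
  qed
  hence "f \<in> irrelevant_ideal V \<longleftrightarrow> 0 \<notin> Poly_Mapping.keys f"
    unfolding I monomial_ideal_def using assms by blast
  thus ?thesis by (simp add: in_keys_iff)
qed

lemma coset_eq_iff:
  assumes I: "homogeneous_ideal V I"
  shows "I +>\<^bsub>poly_ring V\<^esub> x = I +>\<^bsub>poly_ring V\<^esub> y \<longleftrightarrow> x - y \<in> I"
proof -
  have coset: "z \<in> I +>\<^bsub>poly_ring V\<^esub> w \<longleftrightarrow> z - w \<in> I" for z w
  proof -
    have "z \<in> I +>\<^bsub>poly_ring V\<^esub> w \<longleftrightarrow> (\<exists>h\<in>I. z = h + w)"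
      by (auto simp: a_r_coset_defs)
    also have "\<dots> \<longleftrightarrow> z - w \<in> I" by (auto intro: bexI[of _ "z - w"])
    finally show ?thesis .
  qed
  show ?thesis
  proof
    assume "I +>\<^bsub>poly_ring V\<^esub> x = I +>\<^bsub>poly_ring V\<^esub> y"
    moreover have "x \<in> I +>\<^bsub>poly_ring V\<^esub> x" by (simp add: coset hideal_zero[OF I])
    ultimately show "x - y \<in> I" by (simp add: coset)
  next
    assume a: "x - y \<in> I"
    have "z - x \<in> I \<longleftrightarrow> z - y \<in> I" for z
      using hideal_add[OF I _ a, of "z - x"] hideal_diff[OF I _ a, of "z - y"] by auto
    thus "I +>\<^bsub>poly_ring V\<^esub> x = I +>\<^bsub>poly_ring V\<^esub> y" by (auto simp: coset)
  qed
qed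

lemma coset_eq_ideal_iff:
  assumes I: "homogeneous_ideal V I"
  shows "I +>\<^bsub>poly_ring V\<^esub> x = I \<longleftrightarrow> x \<in> I"
proof -
  have "I +>\<^bsub>poly_ring V\<^esub> 0 = I" by (auto simp: a_r_coset_defs)
  thus ?thesis using coset_eq_iff[OF I, of x 0] by simp
qed

section \<open>Graded complexes as augmented complexes\<close>

definition aug_shifts :: "'a::field graded_complex \<Rightarrow> nat \<Rightarrow> nat list" where
  "aug_shifts F i = (case i of 0 \<Rightarrow> [0] | Suc j \<Rightarrow> shifts F j)"

definition aug_diff :: "'a::field graded_complex \<Rightarrow> nat \<Rightarrow> nat \<Rightarrow> nat \<Rightarrow> 'a mpoly" where
  "aug_diff F i = (case i of 0 \<Rightarrow> (\<lambda>a b. aug F b) | Suc j \<Rightarrow> diff F (Suc j))"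

lemma aug_simps [simp]:
  "aug_shifts F 0 = [0]" "aug_shifts F (Suc j) = shifts F j"
  "aug_diff F 0 = (\<lambda>a b. aug F b)" "aug_diff F (Suc j) = diff F (Suc j)"
  by (simp_all add: aug_shifts_def aug_diff_def)

text \<open>Homological degree \<open>i\<close> becomes position \<open>i + 1\<close>, and equality
  of cosets becomes membership of a difference in \<open>I\<close>. The two conditions are
  translated jointly because \<open>is_graded\<close> supplies that the entries lie in
  \<open>R\<close>, which keeps the images inside the modules.\<close>

lemma resolution_iff_aug_resolution:
  fixes I :: "'a::field mpoly set"
  assumes I: "homogeneous_ideal V I"
  shows "is_graded V F \<and> is_resolution V I F \<longleftrightarrow> aug_resolution V I (aug_shifts F) (aug_diff F)"
proof -
  let ?s = "aug_shifts F" and ?D = "aug_diff F"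
  let ?e = "\<lambda>v. \<Sum>a<frank F 0. v a * aug F a"
  have grade: "is_graded V F \<longleftrightarrow> (\<forall>i. graded_map V 0 (?s (Suc i)) (?s i) (?D i))"
  proof -
    have "(\<forall>i. graded_map V 0 (?s (Suc i)) (?s i) (?D i)) \<longleftrightarrow>
      graded_map V 0 (?s (Suc 0)) (?s 0) (?D 0) \<and> (\<forall>i. graded_map V 0 (?s (Suc (Suc i))) (?s (Suc i)) (?D (Suc i)))"
      by (metis not0_implies_Suc)
    thus ?thesis by (simp add: is_graded_def graded_map_def frank_def)
  qed
  have b0: "boundary ?s ?D 0 v a = (if a = 0 then ?e v else 0)" for v a
    by (simp add: mat_apply_def frank_def mult.commute)
  have d: "differential F (Suc i) = boundary ?s ?D (Suc i)" for i
    by (simp add: differential_def frank_def)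
  have surj: "augmentation V I F ` free_module V (frank F 0) = carrier (poly_ring V Quot I) \<longleftrightarrow>
     (\<forall>y\<in>chain_module V ?s 0. \<exists>w\<in>chain_module V ?s 1. \<forall>a. boundary ?s ?D 0 w a - y a \<in> I)"
    (is "?L \<longleftrightarrow> ?R") if gr: "is_graded V F"
  proof -
    have e: "?e v \<in> polys V" if "v \<in> free_module V (frank F 0)" for v
      using gr that by (auto simp: is_graded_def free_module_def intro!: polys_sum polys_mult)
    have car: "carrier (poly_ring V Quot I) = (\<lambda>r. I +>\<^bsub>poly_ring V\<^esub> r) ` polys V"
      by (auto simp: FactRing_def A_RCOSETS_def' )
    have "?L \<longleftrightarrow> (\<forall>r\<in>polys V. \<exists>w\<in>free_module V (frank F 0). ?e w - r \<in> I)"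
    proof -
      have eq: "I +>\<^bsub>poly_ring V\<^esub> r = I +>\<^bsub>poly_ring V\<^esub> ?e w \<longleftrightarrow> ?e w - r \<in> I" for r w
        using coset_eq_iff[OF I, of "?e w" r] by (simp add: eq_commute)
      have "augmentation V I F ` free_module V (frank F 0) \<subseteq> carrier (poly_ring V Quot I)"
        unfolding car augmentation_def using e by blast
      hence "?L \<longleftrightarrow> (\<lambda>r. I +>\<^bsub>poly_ring V\<^esub> r) ` polys V \<subseteq> augmentation V I F ` free_module V (frank F 0)"
        unfolding car by blast
      also have "\<dots> \<longleftrightarrow> (\<forall>r\<in>polys V. \<exists>w\<in>free_module V (frank F 0). I +>\<^bsub>poly_ring V\<^esub> r = I +>\<^bsub>poly_ring V\<^esub> ?e w)"
        unfolding image_subset_iff image_iff augmentation_def ..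
      finally show ?thesis unfolding eq .
    qed
    also have "\<dots> \<longleftrightarrow> ?R"
    proof
      assume L: "\<forall>r\<in>polys V. \<exists>w\<in>free_module V (frank F 0). ?e w - r \<in> I"
      show ?R
      proof
        fix y :: "nat \<Rightarrow> 'a mpoly" assume y: "y \<in> chain_module V ?s 0"
        hence "y 0 \<in> polys V" by (simp add: free_moduleD)
        with L obtain w where "w \<in> free_module V (frank F 0)" "?e w - y 0 \<in> I" by blast
        thus "\<exists>w\<in>chain_module V ?s 1. \<forall>a. boundary ?s ?D 0 w a - y a \<in> I"
          using free_moduleD(2)[OF y] unfolding b0
          by (intro bexI[of _ w]) (auto simp: frank_def hideal_zero[OF I])
      qed
    next
      assume R: ?R
      show "\<forall>r\<in>polys V. \<exists>w\<in>free_module V (frank F 0). ?e w - r \<in> I"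
      proof
        fix r :: "'a mpoly" assume "r \<in> polys V"
        hence "(\<lambda>a. if a = 0 then r else 0) \<in> chain_module V ?s 0" by (simp add: free_module_def)
        from bspec[OF R this] obtain w where w: "w \<in> chain_module V ?s 1"
          "\<forall>a. boundary ?s ?D 0 w a - (if a = 0 then r else 0) \<in> I" by (rule bexE)
        from w(2)[rule_format, of 0] have "?e w - r \<in> I" unfolding b0 by simp
        thus "\<exists>w\<in>free_module V (frank F 0). ?e w - r \<in> I" using w(1) by (auto simp: frank_def)
      qed
    qed
    finally show ?thesis .
  qed
  have zero: "\<zero>\<^bsub>poly_ring V Quot I\<^esub> = I" by (simp add: FactRing_def)
  have ker0: "augmentation V I F v = \<zero>\<^bsub>poly_ring V Quot I\<^esub> \<longleftrightarrow> (\<forall>a. boundary ?s ?D 0 v a \<in> I)" for v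
    unfolding zero augmentation_def coset_eq_ideal_iff[OF I] b0 using hideal_zero[OF I] by auto
  have exact: "{v \<in> free_module V (frank F i). P v} = differential F (Suc i) ` free_module V (frank F (Suc i)) \<longleftrightarrow>
     (\<forall>v\<in>chain_module V ?s (Suc i). P v \<longleftrightarrow> (\<exists>w\<in>chain_module V ?s (Suc (Suc i)). v = boundary ?s ?D (Suc i) w))"
    if gr: "is_graded V F" for i P
  proof -
    have "boundary ?s ?D (Suc i) w \<in> chain_module V ?s (Suc i)" if "w \<in> chain_module V ?s (Suc (Suc i))" for w
      by (rule graded_map_free[OF gr[unfolded grade, rule_format] that])
    thus ?thesis unfolding d by (auto simp: frank_def)
  qed
  have "is_graded V F \<and> is_resolution V I F \<longleftrightarrow> is_graded V F \<and>
     (\<forall>y\<in>chain_module V ?s 0. \<exists>w\<in>chain_module V ?s 1. \<forall>a. boundary ?s ?D 0 w a - y a \<in> I) \<and>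
     (\<forall>v\<in>chain_module V ?s (Suc 0). (\<forall>a. boundary ?s ?D 0 v a \<in> I) \<longleftrightarrow>
        (\<exists>w\<in>chain_module V ?s (Suc (Suc 0)). v = boundary ?s ?D (Suc 0) w)) \<and>
     (\<forall>i\<ge>1. \<forall>v\<in>chain_module V ?s (Suc i). (differential F i v = (\<lambda>_. 0)) \<longleftrightarrow>
        (\<exists>w\<in>chain_module V ?s (Suc (Suc i)). v = boundary ?s ?D (Suc i) w))"
    unfolding is_resolution_def ker0 using surj exact[of 0] exact by (simp only: One_nat_def cong: conj_cong)
  also have "\<dots> \<longleftrightarrow> aug_resolution V I ?s ?D"
  proof -
    have 1: "(\<forall>i\<ge>1. Q i) \<longleftrightarrow> (\<forall>i. Q (Suc i))" for Q :: "nat \<Rightarrow> bool"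
      by (metis One_nat_def Suc_le_D Suc_le_mono le0)
    have 2: "(\<forall>i. Q i) \<longleftrightarrow> Q 0 \<and> (\<forall>i. Q (Suc i))" for Q :: "nat \<Rightarrow> bool"
      by (metis not0_implies_Suc)
    have 3: "differential F (Suc i) v = (\<lambda>_. 0) \<longleftrightarrow> (\<forall>a. boundary ?s ?D (Suc i) v a \<in> target_ideal I (Suc i))" for i v
      unfolding d by (auto simp: target_ideal_def fun_eq_iff)
    have 4: "target_ideal I 0 = I" by (simp add: target_ideal_def)
    show ?thesis
      unfolding aug_resolution_def grade 1 3
        2[of "\<lambda>i. \<forall>v\<in>chain_module V ?s (Suc i). (\<forall>a. boundary ?s ?D i v a \<in> target_ideal I i) \<longleftrightarrow>
        (\<exists>w\<in>chain_module V ?s (Suc (Suc i)). v = boundary ?s ?D (Suc i) w)"] 4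
      by (simp only: aug_simps(1) simp_thms)
  qed
  finally show ?thesis .
qed

lemma is_minimal_iff:
  assumes "is_graded V F"
  shows "is_minimal V F \<longleftrightarrow> minimal_complex (aug_shifts F) (aug_diff F)"
proof -
  have "diff F (Suc i) a b \<in> irrelevant_ideal V \<longleftrightarrow> Poly_Mapping.lookup (diff F (Suc i) a b) 0 = 0"
    if "a < frank F i" "b < frank F (Suc i)" for i a b
    by (rule irrelevant_ideal_iff) (use assms that in \<open>auto simp: is_graded_def\<close>)
  thus ?thesis by (auto simp: is_minimal_def minimal_complex_def frank_def)
qed

text \<open>Needed because \<open>aug_diff F 0\<close> ignores its row index, so it agrees with a
  given matrix only inside the matrix bounds.\<close>

lemma aug_resolution_cong:
  assumes "\<And>i a b. a < length (s i) \<Longrightarrow> b < length (s (Suc i)) \<Longrightarrow> D i a b = D' i a b"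
    and "aug_resolution V I s D"
  shows "aug_resolution V I s D'"
proof -
  have b: "boundary s D i = boundary s D' i" for i
    using assms(1)[of _ i] by (auto simp: mat_apply_def fun_eq_iff intro!: sum.cong)
  have g: "graded_map V 0 (s (Suc i)) (s i) (D i) = graded_map V 0 (s (Suc i)) (s i) (D' i)" for i
    using assms(1)[of _ i] by (simp add: graded_map_def)
  show ?thesis using assms(2) unfolding aug_resolution_def b g .
qed

lemma graded_betti_eq:
  fixes I :: "'a::field mpoly set"
  assumes I: "homogeneous_ideal V I" and res: "aug_resolution V I s D" "minimal_complex s D"
  shows "graded_betti V I i j = count_list (s (Suc i)) j"
  unfolding graded_betti_def
proof (rule the_equality)
  have s0: "s 0 = [0]" using res(1) by (simp add: aug_resolution_def)
  \<comment> \<open>Since \<open>s 0 = [0]\<close>, the matrix \<open>D 0\<close> has a single row,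
    and this row is the augmentation.\<close>
  define F where "F = \<lparr>shifts = (\<lambda>i. s (Suc i)), diff = D, aug = D 0 0\<rparr>"
  have s: "aug_shifts F = s" by (auto simp: fun_eq_iff aug_shifts_def F_def s0 split: nat.split)
  have D: "D i a b = aug_diff F i a b" if "a < length (s i)" for i a b
    using that by (cases i) (auto simp: F_def s0)
  have "aug_resolution V I (aug_shifts F) (aug_diff F)"
    unfolding s by (rule aug_resolution_cong[OF _ res(1)]) (rule D)
  moreover have "minimal_complex (aug_shifts F) (aug_diff F)"
    using res(2) unfolding s by (simp add: minimal_complex_def F_def)
  ultimately have "minimal_graded_free_resolution V I F"
    unfolding minimal_graded_free_resolution_def
    using resolution_iff_aug_resolution[OF I, of F] is_minimal_iff[of V F] by blast
  moreover have "shifts F i = s (Suc i)" by (simp add: F_def)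
  ultimately show "\<exists>F. minimal_graded_free_resolution V I F \<and> count_list (s (Suc i)) j = count_list (shifts F i) j"
    by metis
next
  fix b assume "\<exists>F. minimal_graded_free_resolution V I F \<and> b = count_list (shifts F i) j"
  then obtain F where F: "minimal_graded_free_resolution V I F" "b = count_list (shifts F i) j" by blast
  hence "aug_resolution V I (aug_shifts F) (aug_diff F)" "minimal_complex (aug_shifts F) (aug_diff F)"
    unfolding minimal_graded_free_resolution_def
    using resolution_iff_aug_resolution[OF I, of F] is_minimal_iff[of V F] by blast+
  from minimal_shifts_unique[OF I this res, of i j] F(2) show "b = count_list (s (Suc i)) j" by simp
qed

text \<open>A pair is a nonedge exactly if its larger member is in \<open>\<sigma>\<close>. The
  bound \<open>Suc n\<close> exceeds every member of \<open>\<sigma>\<close>, so all generators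
  count as earlier.\<close>

lemma nonedge_ideal_threshold_graph:
  assumes "\<sigma> \<subseteq> {0..n}"
  shows "nonedge_ideal (threshold_graph n \<sigma>) = (monomial_ideal {0..n} (earlier_pairs \<sigma> (Suc n) 0) :: 'a::field mpoly set)"
proof -
  let ?G = "{Poly_Mapping.single u (1::nat) + Poly_Mapping.single v 1 | u v. u < v \<and> v \<in> \<sigma>}"
  have "{var u * var v | u v. u \<in> fst (threshold_graph n \<sigma>) \<and> v \<in> fst (threshold_graph n \<sigma>) \<and> u \<noteq> v \<and>
      {u, v} \<notin> snd (threshold_graph n \<sigma>)} = (\<lambda>g. Poly_Mapping.single g (1::'a)) ` ?G" (is "?L = ?R")
  proof -
    have E: "{u, v} \<in> snd (threshold_graph n \<sigma>) \<longleftrightarrow> v \<notin> \<sigma>" if "u < v" "v \<le> n" for u v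
      using that by (auto simp: threshold_graph_def doubleton_eq_iff)
    have V: "fst (threshold_graph n \<sigma>) = {0..n}" by (simp add: threshold_graph_def)
    have var: "var u * var v = Poly_Mapping.single (Poly_Mapping.single u 1 + Poly_Mapping.single v 1) (1::'a)" for u v
      by (simp add: var_def mult_single)
    have "x \<in> ?R" if x: "x \<in> ?L" for x
    proof -
      from x obtain u v where uv: "x = var u * var v" "u \<le> n" "v \<le> n" "u \<noteq> v" "{u, v} \<notin> snd (threshold_graph n \<sigma>)"
        unfolding V by auto
      show ?thesis
      proof (cases "u < v")
        case True
        thus ?thesis using uv E[of u v] unfolding var by blast
      next
        case False
        hence "v < u" "u \<in> \<sigma>" using uv E[of v u] by (auto simp: insert_commute)
        moreover have "x = var v * var u" using uv(1) by (simp add: mult.commute)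
        ultimately show ?thesis unfolding var by blast
      qed
    qed
    moreover have "x \<in> ?L" if x: "x \<in> ?R" for x
    proof -
      from x obtain u v where uv: "x = var u * var v" "u < v" "v \<in> \<sigma>" unfolding var by blast
      hence "v \<le> n" using assms by auto
      thus ?thesis using uv E[of u v] unfolding V by force
    qed
    ultimately show ?thesis by blast
  qed
  hence "nonedge_ideal (threshold_graph n \<sigma>) = Idl\<^bsub>poly_ring {0..n}\<^esub> ((\<lambda>g. Poly_Mapping.single g (1::'a)) ` ?G)"
    by (simp add: nonedge_ideal_def threshold_graph_def)
  also have "\<dots> = monomial_ideal {0..n} {g + m | g m. g \<in> ?G}"
    by (rule genideal_monomials) (use assms in \<open>fastforce simp: keys_add_nat\<close>)
  also have "\<dots> = monomial_ideal {0..n} (earlier_pairs \<sigma> (Suc n) 0)"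
  proof -
    have "{g + m | g m. g \<in> ?G} = earlier_pairs \<sigma> (Suc n) 0"
    proof (intro equalityI subsetI)
      fix k assume "k \<in> {g + m | g m. g \<in> ?G}"
      then obtain u v m where k: "k = Poly_Mapping.single u 1 + Poly_Mapping.single v 1 + m" "u < v" "v \<in> \<sigma>" by blast
      thus "k \<in> earlier_pairs \<sigma> (Suc n) 0"
        using assms by (intro earlier_pairsI[of v _ u]) (auto simp: keys_add_nat)
    next
      fix k assume "k \<in> earlier_pairs \<sigma> (Suc n) 0"
      then obtain u v where uv: "v \<in> \<sigma>" "u < v" "u \<in> Poly_Mapping.keys k" "v \<in> Poly_Mapping.keys k"
        unfolding earlier_pairs_def by blast
      from mon_split[OF uv(3)] obtain m' where m': "k = Poly_Mapping.single u 1 + m'" ..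
      hence "v \<in> Poly_Mapping.keys m'" using uv by (simp add: keys_add_nat)
      from mon_split[OF this] obtain m'' where "m' = Poly_Mapping.single v 1 + m''" ..
      hence "k = (Poly_Mapping.single u 1 + Poly_Mapping.single v 1) + m''" using m' by (simp add: add.assoc)
      thus "k \<in> {g + m | g m. g \<in> ?G}" using uv by blast
    qed
    thus ?thesis by simp
  qed
  finally show ?thesis .
qed

text \<open>All shifts in position \<open>j + 2\<close> of the linear resolution equal
  \<open>j + 2\<close>, so the graded Betti number is the whole rank.\<close>

lemma betti_threshold_graph:
  assumes "\<sigma> \<subseteq> {0..n}"
  shows "betti TYPE('a::field) (threshold_graph n \<sigma>) (Suc j)
       = (\<Sum>v\<in>\<sigma>. \<Sum>u<v. colon_size \<sigma> u v choose j)"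
proof -
  let ?c = "\<lambda>j. \<Sum>b | b < Suc n \<and> b \<in> \<sigma>. \<Sum>a<b. colon_size \<sigma> a b choose j"
  from has_shifts_earlier_pairs[of "Suc n" n \<sigma>, where ?'a = 'a] obtain D where
    D: "up_closed (earlier_pairs \<sigma> (Suc n) 0)"
      "aug_resolution {0..n} (monomial_ideal {0..n} (earlier_pairs \<sigma> (Suc n) 0) :: 'a mpoly set) (linear_shifts ?c) D"
      "minimal_complex (linear_shifts ?c) D"
    by (auto simp: has_shifts_def)
  have "betti TYPE('a) (threshold_graph n \<sigma>) (Suc j) = graded_betti {0..n}
      (monomial_ideal {0..n} (earlier_pairs \<sigma> (Suc n) 0) :: 'a mpoly set) (Suc j) (Suc (Suc j))"
    by (simp add: betti_def nonedge_ideal_threshold_graph[OF assms]) (simp add: threshold_graph_def)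
  also have "\<dots> = count_list (linear_shifts ?c (Suc (Suc j))) (Suc (Suc j))"
    by (rule graded_betti_eq[OF homogeneous_ideal_monomial[OF D(1)] D(2,3)])
  also have "\<dots> = ?c j"
    by (simp only: linear_shifts_simps count_list_conv_card) (auto intro!: arg_cong[of _ _ card] simp: conj_commute cong: conj_cong)
  also have "{b. b < Suc n \<and> b \<in> \<sigma>} = \<sigma>" using assms by auto
  finally show ?thesis .
qed

section \<open>The expected anti-lecture hall composition\<close>

text \<open>The product of binomials factors as \<open>a choose q\<close> times
  \<open>(a - q) choose (j - q)\<close>, and an alternating row sum of Pascal's triangle vanishes
  except in row 0.\<close>

lemma binomial_inversion:
  assumes "a \<le> N"
  shows "(\<Sum>j=q..N. (-1) ^ (q + j) * int (j choose q) * int (a choose j)) = (if a = q then 1 else 0)"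
proof (cases "q \<le> a")
  case False
  thus ?thesis by (intro trans[OF sum.neutral]) auto
next
  case True
  have "(\<Sum>j=q..N. (-1) ^ (q + j) * int (j choose q) * int (a choose j))
      = (\<Sum>j=q..a. (-1) ^ (q + j) * int (j choose q) * int (a choose j))"
    by (rule sum.mono_neutral_right) (use assms in auto)
  also have "\<dots> = (\<Sum>l\<le>a - q. (-1) ^ l * int (a choose q) * int ((a - q) choose l))"
  proof (rule sum.reindex_bij_witness[where i = "\<lambda>l. l + q" and j = "\<lambda>j. j - q"])
    fix j assume j: "j \<in> {q..a}"
    have "(a choose j) * (j choose q) = (a choose q) * ((a - q) choose (j - q))"
      by (rule choose_mult) (use j in auto)
    hence "int (j choose q) * int (a choose j) = int (a choose q) * int ((a - q) choose (j - q))"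
      by (metis mult.commute of_nat_mult)
    \<comment> \<open>The exponents \<open>q + j\<close> and \<open>j - q\<close> differ by the even
      number \<open>2 * q\<close>.\<close>
    moreover have "(-1 :: int) ^ (q + j) = (-1) ^ (j - q)"
      using j by (simp add: minus_one_power_iff)
    ultimately show "(-1) ^ (j - q) * int (a choose q) * int ((a - q) choose (j - q))
        = (-1) ^ (q + j) * int (j choose q) * int (a choose j)"
      by (simp add: mult.assoc)
  qed (use True in auto)
  also have "\<dots> = int (a choose q) * (\<Sum>l\<le>a - q. (-1) ^ l * of_nat ((a - q) choose l))"
    by (simp add: sum_distrib_left mult_ac)
  also have "\<dots> = (if a = q then 1 else 0)"
    using True choose_alternating_sum[of "a - q", where ?'a = int] by auto
  finally show ?thesis .
qed

text \<open>Only \<open>v - u - 1\<close> vertices lie between \<open>u\<close> and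
  \<open>v\<close>. The bound guarantees that the sum up to \<open>n\<close> in
  \<open>alh_composition\<close> is long enough for the inversion.\<close>

lemma colon_size_less:
  assumes "u < v"
  shows "colon_size \<sigma> u v < v"
proof -
  have "card {b \<in> {u<..<v}. b \<in> \<sigma>} \<le> card {u<..<v}" by (rule card_mono) auto
  thus ?thesis using assms by (simp add: colon_size_def)
qed

text \<open>After interchange of the sums the inversion acts on each generator separately, and a
  generator contributes only to the part with index
  \<open>colon_size \<sigma> u v + 1\<close>.\<close>

lemma alh_composition_threshold_graph:
  assumes \<sigma>: "\<sigma> \<subseteq> {1..n}" and k: "1 \<le> k" "k \<le> n"
  shows "alh_composition TYPE('a::field) n (threshold_graph n \<sigma>) k
       = (\<Sum>v\<in>\<sigma>. \<Sum>u<v. if colon_size \<sigma> u v = k - 1 then 1 else 0)"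
proof -
  obtain q N where q: "k = Suc q" "n = Suc N" using k by (cases k; cases n) auto
  have \<sigma>0: "\<sigma> \<subseteq> {0..n}" using \<sigma> by auto
  have "alh_composition TYPE('a) n (threshold_graph n \<sigma>) k
      = (\<Sum>j=q..N. (-1) ^ (q + j) * int (j choose q) * int (\<Sum>v\<in>\<sigma>. \<Sum>u<v. colon_size \<sigma> u v choose j))"
    unfolding alh_composition_def q sum.shift_bounds_cl_Suc_ivl
    using betti_threshold_graph[OF \<sigma>0, where ?'a = 'a] by (simp add: q)
  also have "\<dots> = (\<Sum>v\<in>\<sigma>. \<Sum>u<v. \<Sum>j=q..N. (-1) ^ (q + j) * int (j choose q) * int (colon_size \<sigma> u v choose j))"
    unfolding of_nat_sum sum_distrib_left by (subst sum.swap) (intro sum.cong refl sum.swap)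
  also have "\<dots> = (\<Sum>v\<in>\<sigma>. \<Sum>u<v. if colon_size \<sigma> u v = q then 1 else 0)"
  proof (intro sum.cong refl binomial_inversion)
    fix u v assume "v \<in> \<sigma>" "u \<in> {..<v}"
    thus "colon_size \<sigma> u v \<le> N" using colon_size_less[of u v \<sigma>] \<sigma> q by fastforce
  qed
  finally show ?thesis by (simp add: q)
qed

text \<open>The coordinate \<open>v\<close> and the coordinates strictly between \<open>u\<close>
  and \<open>v\<close> are disjoint families, so the probability is \<open>p\<close> times a point
  probability of a binomial distribution with \<open>v - u - 1\<close> trials.\<close>

lemma prob_colon_size:
  assumes p: "0 \<le> p" "p \<le> 1" and uv: "u < v" "v \<le> n"
  shows "measure_pmf.prob (Pi_pmf {1..n} False (\<lambda>_. bernoulli_pmf p))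
          {f. f v \<and> u + card {b \<in> {u<..<v}. f b} = q}
       = (if u \<le> q then p * (real ((v - u - 1) choose (q - u)) * p ^ (q - u) * (1 - p) ^ (v - u - 1 - (q - u))) else 0)"
proof -
  let ?B = "\<lambda>_ :: nat. bernoulli_pmf p" and ?A = "{u<..<v}"
  let ?C = "\<lambda>f. card {b \<in> ?A. f b}"
  let ?E = "{f. f v \<and> u + ?C f = q}"
  have "measure_pmf.prob (Pi_pmf {1..n} False ?B) ?E
      = measure_pmf.prob (Pi_pmf {1..n} False ?B) ((\<lambda>f x. if x \<in> insert v ?A then f x else False) -` ?E)"
    by (rule arg_cong[where f = "measure_pmf.prob _"]) (auto cong: conj_cong)
  also have "\<dots> = measure_pmf.prob (map_pmf (\<lambda>f x. if x \<in> insert v ?A then f x else False) (Pi_pmf {1..n} False ?B)) ?E"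
    by simp
  also have "map_pmf (\<lambda>f x. if x \<in> insert v ?A then f x else False) (Pi_pmf {1..n} False ?B) = Pi_pmf (insert v ?A) False ?B"
    by (rule Pi_pmf_subset[symmetric]) (use uv in auto)
  also have "\<dots> = map_pmf (\<lambda>(y, f). f(v := y)) (pair_pmf (bernoulli_pmf p) (Pi_pmf ?A False ?B))"
    by (rule Pi_pmf_insert) auto
  also have "measure_pmf.prob \<dots> ?E = measure_pmf.prob (pair_pmf (bernoulli_pmf p) (Pi_pmf ?A False ?B)) ({True} \<times> {f. u + ?C f = q})"
  proof -
    have "(\<lambda>(y, f). f(v := y)) -` ?E = {True} \<times> {f. u + ?C f = q}"
    proof -
      have "{b \<in> ?A. (f(v := y)) b} = {b \<in> ?A. f b}" for f y by auto
      thus ?thesis by auto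
    qed
    thus ?thesis by simp
  qed
  also have "{True} \<times> {f. u + ?C f = q} = apsnd ?C -` ({True} \<times> {c. u + c = q})" by auto
  also have "measure_pmf.prob (pair_pmf (bernoulli_pmf p) (Pi_pmf ?A False ?B)) \<dots>
      = measure_pmf.prob (pair_pmf (bernoulli_pmf p) (map_pmf ?C (Pi_pmf ?A False ?B))) ({True} \<times> {c. u + c = q})"
    unfolding pair_map_pmf2 by simp
  also have "\<dots> = measure_pmf.prob (bernoulli_pmf p) {True} * measure_pmf.prob (map_pmf ?C (Pi_pmf ?A False ?B)) {c. u + c = q}"
    by (rule measure_pmf_prob_product) auto
  also have "measure_pmf.prob (bernoulli_pmf p) {True} = p"
    using p by (simp add: measure_pmf_single)
  also have "map_pmf ?C (Pi_pmf ?A False ?B) = binomial_pmf (v - u - 1) p"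
    by (rule binomial_pmf_altdef'[symmetric]) (use p in auto)
  also have "{c. u + c = q} = (if u \<le> q then {q - u} else {})" by auto
  finally show ?thesis using p by (simp add: measure_pmf_single)
qed

lemma expectation_alh_composition:
  assumes p: "0 \<le> p" "p \<le> 1" and k: "1 \<le> k" "k \<le> n"
  shows "measure_pmf.expectation (random_threshold_graph n p) (\<lambda>T. real_of_int (alh_composition TYPE('a::field) n T k))
    = (\<Sum>v\<in>{1..n}. \<Sum>u<v. if u < k then p * (real ((v - u - 1) choose (k - 1 - u)) * p ^ (k - 1 - u) *
         (1 - p) ^ (v - u - 1 - (k - 1 - u))) else 0)"
proof -
  let ?P = "Pi_pmf {1..n} False (\<lambda>_. bernoulli_pmf p)"
  let ?E = "\<lambda>u v. {f. f v \<and> u + card {b \<in> {u<..<v}. f b} = k - 1}"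
  have alh: "real_of_int (alh_composition TYPE('a) n (threshold_graph n {i \<in> {1..n}. f i}) k)
      = (\<Sum>v\<in>{1..n}. \<Sum>u<v. indicator (?E u v) f)" for f
  proof -
    let ?\<sigma> = "{i \<in> {1..n}. f i}"
    have "real_of_int (alh_composition TYPE('a) n (threshold_graph n ?\<sigma>) k)
        = (\<Sum>v\<in>?\<sigma>. \<Sum>u<v. if colon_size ?\<sigma> u v = k - 1 then 1 else 0)"
      by (subst alh_composition_threshold_graph[OF _ k]) (auto simp: if_distrib cong: if_cong)
    also have "\<dots> = (\<Sum>v\<in>{1..n}. if f v then \<Sum>u<v. if colon_size ?\<sigma> u v = k - 1 then 1 else 0 else 0)"
      by (rule sum.inter_filter) auto
    also have "\<dots> = (\<Sum>v\<in>{1..n}. \<Sum>u<v. indicator (?E u v) f)"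
    proof (rule sum.cong[OF refl])
      fix v assume v: "v \<in> {1..n}"
      have "colon_size ?\<sigma> u v = u + card {b \<in> {u<..<v}. f b}" for u
      proof -
        \<comment> \<open>The open interval stays inside \<open>{1..n}\<close> even for
          \<open>u = 0\<close>, so cutting \<open>f\<close> down to \<open>{1..n}\<close> does not
          change the count.\<close>
        have "{b \<in> {u<..<v}. b \<in> ?\<sigma>} = {b \<in> {u<..<v}. f b}" using v by auto
        thus ?thesis by (simp add: colon_size_def)
      qed
      hence "(if colon_size ?\<sigma> u v = k - 1 then 1 else 0) = (indicator (?E u v) f :: real)" if "f v" for u
        using that by (simp add: indicator_def)
      thus "(if f v then \<Sum>u<v. if colon_size ?\<sigma> u v = k - 1 then 1 else 0 else 0)
          = (\<Sum>u<v. indicator (?E u v) f :: real)"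
        by (cases "f v") (simp_all only: if_True if_False, simp)
    qed
    finally show ?thesis .
  qed
  have "measure_pmf.expectation (random_threshold_graph n p) (\<lambda>T. real_of_int (alh_composition TYPE('a) n T k))
      = measure_pmf.expectation ?P (\<lambda>f. \<Sum>v\<in>{1..n}. \<Sum>u<v. indicator (?E u v) f)"
    unfolding random_threshold_graph_def integral_map_pmf alh ..
  also have "\<dots> = (\<Sum>v\<in>{1..n}. \<Sum>u<v. measure_pmf.expectation ?P (indicator (?E u v)))"
  proof -
    have int: "integrable (measure_pmf ?P) (indicator (?E u v) :: _ \<Rightarrow> real)" for u v
      by (rule integrable_real_indicator) (auto simp: less_top[symmetric])
    show ?thesis
      by (subst Bochner_Integration.integral_sum, intro Bochner_Integration.integrable_sum int)
        (intro sum.cong refl Bochner_Integration.integral_sum int)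
  qed
  also have "\<dots> = (\<Sum>v\<in>{1..n}. \<Sum>u<v. measure_pmf.prob ?P (?E u v))"
    by simp
  also have "\<dots> = (\<Sum>v\<in>{1..n}. \<Sum>u<v. if u < k then p * (real ((v - u - 1) choose (k - 1 - u)) * p ^ (k - 1 - u) *
         (1 - p) ^ (v - u - 1 - (k - 1 - u))) else 0)"
  proof (intro sum.cong refl)
    fix v u assume "v \<in> {1..n}" "u \<in> {..<v}"
    hence "u < v" "v \<le> n" by auto
    moreover have "u \<le> k - 1 \<longleftrightarrow> u < k" using k by auto
    ultimately show "measure_pmf.prob ?P (?E u v) = (if u < k then p * (real ((v - u - 1) choose (k - 1 - u)) * p ^ (k - 1 - u) *
         (1 - p) ^ (v - u - 1 - (k - 1 - u))) else 0)"
      using prob_colon_size[OF p, of u v n "k - 1"] by simp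
  qed
  finally show ?thesis .
qed

theorem theorem4p13:
  fixes p :: real and n k m :: nat
  assumes "0 \<le> p" and "p \<le> 1"
    and "1 \<le> k" and "k \<le> n"
    and "m = n - k + 1"
  shows "measure_pmf.expectation (random_threshold_graph n p)
           (\<lambda>T. real_of_int (alh_composition TYPE('a::field) n T k))
         = (\<Sum>(i, j) \<in> {(i, j). 1 \<le> i \<and> i \<le> m \<and> m \<le> j \<and> j \<le> n}.
              real ((j - i) choose (m - i)) * p ^ (j - m + 1) * (1 - p) ^ (m - i))"
proof -
  let ?g = "\<lambda>v u. p * (real ((v - u - 1) choose (k - 1 - u)) * p ^ (k - 1 - u) * (1 - p) ^ (v - u - 1 - (k - 1 - u)))"
  let ?S = "{(i, j). 1 \<le> i \<and> i \<le> m \<and> m \<le> j \<and> j \<le> n}"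
  have "(\<Sum>v\<in>{1..n}. \<Sum>u<v. if u < k then ?g v u else 0)
      = (\<Sum>(v, u)\<in>(SIGMA v:{1..n}. {..<v}). if u < k then ?g v u else 0)"
    by (rule sum.Sigma) auto
  also have "\<dots> = (\<Sum>(v, u)\<in>{(v, u). k \<le> v \<and> v \<le> n \<and> u < k}. ?g v u)"
  proof (rule sum.mono_neutral_cong_right)
    show "{(v, u). k \<le> v \<and> v \<le> n \<and> u < k} \<subseteq> (SIGMA v:{1..n}. {..<v})"
      using assms(3) by auto
    \<comment> \<open>For \<open>u < v < k\<close> the lower index of the binomial coefficient
      exceeds the upper one.\<close>
    have "(if u < k then ?g v u else 0) = 0" if "v \<le> n" "u < v" "\<not> (k \<le> v \<and> u < k)" for u v
    proof (cases "u < k")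
      case True
      hence "v - u - 1 < k - 1 - u" using that by auto
      thus ?thesis by (simp add: binomial_eq_0)
    qed simp
    thus "\<forall>x\<in>(SIGMA v:{1..n}. {..<v}) - {(v, u). k \<le> v \<and> v \<le> n \<and> u < k}.
        (case x of (v, u) \<Rightarrow> if u < k then ?g v u else 0) = 0"
      by fastforce
  qed auto
  also have "\<dots> = (\<Sum>(i, j)\<in>?S. real ((j - i) choose (m - i)) * p ^ (j - m + 1) * (1 - p) ^ (m - i))"
  \<comment> \<open>Under \<open>i = n + 1 - v\<close> and \<open>j = n - u\<close>, the range
    \<open>k \<le> v \<le> n\<close> becomes \<open>1 \<le> i \<le> m\<close>, and
    \<open>0 \<le> u < k\<close> becomes \<open>m \<le> j \<le> n\<close>.\<close>
  proof (rule sum.reindex_bij_witness[where i = "\<lambda>(i, j). (n + 1 - i, n - j)" and j = "\<lambda>(v, u). (n + 1 - v, n - u)"])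
    fix a assume "a \<in> {(v, u). k \<le> v \<and> v \<le> n \<and> u < k}"
    then obtain v u where a: "a = (v, u)" "k \<le> v" "v \<le> n" "u < k" by auto
    show "(case a of (v, u) \<Rightarrow> (n + 1 - v, n - u)) \<in> ?S" using a assms by auto
    show "(case case a of (v, u) \<Rightarrow> (n + 1 - v, n - u) of (i, j) \<Rightarrow> (n + 1 - i, n - j)) = a"
      using a assms by auto
    have e: "n - u - (n + 1 - v) = v - u - 1" "m - (n + 1 - v) = v - k" "n - u - m = k - 1 - u"
        "v - u - 1 - (k - 1 - u) = v - k"
      using a assms by auto
    \<comment> \<open>The lower indices \<open>v - k\<close> and \<open>k - 1 - u\<close> add up to
      \<open>v - u - 1\<close>.\<close>
    have "(v - u - 1) choose (v - k) = (v - u - 1) choose (k - 1 - u)"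
      by (subst binomial_symmetric) (use a in \<open>auto intro: arg_cong\<close>)
    thus "(case case a of (v, u) \<Rightarrow> (n + 1 - v, n - u) of (i, j) \<Rightarrow>
          real ((j - i) choose (m - i)) * p ^ (j - m + 1) * (1 - p) ^ (m - i)) = (case a of (v, u) \<Rightarrow> ?g v u)"
      unfolding a(1) prod.case e by simp
  next
    fix b assume "b \<in> ?S"
    then obtain i j where b: "b = (i, j)" "1 \<le> i" "i \<le> m" "m \<le> j" "j \<le> n" by auto
    show "(case b of (i, j) \<Rightarrow> (n + 1 - i, n - j)) \<in> {(v, u). k \<le> v \<and> v \<le> n \<and> u < k}"
      using b assms by auto
    show "(case case b of (i, j) \<Rightarrow> (n + 1 - i, n - j) of (v, u) \<Rightarrow> (n + 1 - v, n - u)) = b"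
      using b assms by auto
  qed
  finally show ?thesis by (simp only: expectation_alh_composition[OF assms(1-4)])
qed

end
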